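(* Let $1\le q\le\infty$, $0\le\gamma<\alpha$, and let $(\varphi_j)_{j\in\mathbb Z_+}$ and $(\widetilde\varphi_j)_{j\in\mathbb Z_+}$ be such that $\widetilde\varphi_j\in\mathcal D'(\mathbb T)$ and $\varphi_j\in\mathcal T_j^1$ for each $j\in\mathbb Z_+$. Suppose that for some $N\ge 0$ and $s>0$ there are constants $C_{\widetilde\varphi},C_\varphi,C_{\varphi,\widetilde\varphi,s}$ such that for all $j\in\mathbb Z_+$: $$|\widehat{\widetilde\varphi_j}(\ell)|\le C_{\widetilde\varphi}(1+|2^{-j}\ell|^N)\ \text{ for all }\ell\in\mathbb Z,\qquad |\widehat{\varphi_j}(\ell)|\le C_\varphi\ \text{ for all }\ell\in\mathbb Z,$$ $$|1-\widehat{\varphi_j}(\ell)\widehat{\widetilde\varphi_j}(\ell)|\le C_{\varphi,\widetilde\varphi,s}|2^{-j}\ell|^s\ \text{ for all }\ell\in D_j.$$ Further suppose that at least one of the following holds: (i) $\alpha>N+1/q'$ if $q\ne1$, and $\alpha\ge N$ if $q=1$; or (ii) $N=0$ and $\sup_{j\in\mathbb Z_+}\|\widetilde\varphi_j\|_{\widetilde A_{q',j}(\mathbb T)}<\infty$. Then there is a constant $C>0$, independent of $f$ and $j$, such that for all $f\in A_q^\alpha(\mathbb T)$ and $j\in\mathbb Z_+$, $$\|f-Q_j(f,\varphi_j,\widetilde\varphi_j)\|_{A_q^\gamma(\mathbb T)}\le C\,2^{-j\min(\alpha-\gamma,s)}\|f\|_{A_q^\alpha(\mathbb T)}.$$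
   Context: $\mathbb T=\mathbb R/2\pi\mathbb Z$, $\mathbb Z_+=\{0,1,2,\dots\}$, $\frac1q+\frac1{q'}=1$, $\widehat f(k)=(2\pi)^{-1}\int_{\mathbb T}f(x)e^{-\mathrm i kx}dx$. The Wiener space $A_q^\alpha(\mathbb T)$ is the set of $f\in L_1(\mathbb T)$ with finite $\|f\|_{A_q^\alpha(\mathbb T)}=\big(\sum_{k\in\mathbb Z}(1+|k|)^{q\alpha}|\widehat f(k)|^q\big)^{1/q}$ (supremum if $q=\infty$). $D_j=[-2^{j-1},2^{j-1})\cap\mathbb Z$; $\mathcal T_j^1=\mathrm{span}\{e^{\mathrm i kx}:k\in D_j\}$. $\mathcal D'(\mathbb T)$ is the space of periodic distributions on $\mathbb T$, with Fourier expansions $\widetilde\varphi=\sum_{k\in\mathbb Z}\widehat{\widetilde\varphi}(k)e^{\mathrm i kx}$. Amalgam-type norm: $\|\psi\|_{\widetilde A_{r,j}(\mathbb T)}=\sup_{\ell\in D_j}\big(\sum_{\mu\in\mathbb Z}|\widehat\psi(\ell+2^j\mu)|^r\big)^{1/r}$ for $1\le r<\infty$, and $\|\psi\|_{\widetilde A_{\infty,j}(\mathbb T)}=\sup_{k\in\mathbb Z}|\widehat\psi(k)|$ (defined through Fourier coefficients, possibly $+\infty$). Quasi-interpolation operator: $Q_j(f,\varphi_j,\widetilde\varphi_j)(x)=2^{-j}\sum_{k\in D_j}(f*\widetilde\varphi_j)(x_k^j)\,\varphi_j(x-x_k^j)$, $x_k^j=\pi k/2^{j-1}$, where $(f*\widetilde\varphi_j)(x)=\sum_{\nu\in\mathbb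 Z}\widehat f(\nu)\widehat{\widetilde\varphi_j}(\nu)e^{\mathrm i\nu x}$; equivalently $Q_j(f,\varphi_j,\widetilde\varphi_j)(x)=\sum_{\ell\in D_j}\widehat{\varphi_j}(\ell)\big(\sum_{\mu\in\mathbb Z}\widehat f(\ell+2^j\mu)\widehat{\widetilde\varphi_j}(\ell+2^j\mu)\big)e^{\mathrm i\ell x}$. *)

theory Defs
  imports "HOL-Analysis.Analysis"
begin

text \<open>
  The library has \<^term>\<open>(0::real) powr 0 = 0\<close>. In a bound such as
  \<open>1 + \<bar>2\<^sup>-\<^sup>j l\<bar>\<^sup>N\<close> the convention is \<open>x\<^sup>0 = 1\<close>, also for \<open>x = 0\<close>.
\<close>
definition rpow :: "real \<Rightarrow> real \<Rightarrow> real" where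
  "rpow x a = (if a = 0 then 1 else x powr a)"

text \<open>Only used for exponents \<open>a > 0\<close>.\<close>
definition ennpow :: "ennreal \<Rightarrow> real \<Rightarrow> ennreal" where
  "ennpow x a = (if x = top then top else ennreal (enn2real x powr a))"

definition lp_norm :: "ennreal \<Rightarrow> (int \<Rightarrow> complex) \<Rightarrow> ennreal" where
  "lp_norm p a =
     (if p = top then (SUP k. ennreal (norm (a k)))
      else ennpow (\<Sum>\<^sub>\<infinity>k\<in>UNIV. ennreal (norm (a k) powr enn2real p)) (1 / enn2real p))"

text \<open>
  Functions on \<open>\<real> / 2\<pi>\<int>\<close> are \<open>2\<pi>\<close>-periodic functions on the real line; elements of \<open>L\<^sub>1\<close> are
  given by representatives.
\<close>
definition periodic2pi :: "(real \<Rightarrow> complex) \<Rightarrow> bool" where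
  "periodic2pi f \<longleftrightarrow> (\<forall>x. f (x + 2 * pi) = f x)"

definition L1_torus :: "(real \<Rightarrow> complex) set" where
  "L1_torus = {f. periodic2pi f \<and> f absolutely_integrable_on {-pi..pi}}"

definition expi :: "int \<Rightarrow> real \<Rightarrow> complex" where
  "expi k x = exp (\<i> * of_int k * of_real x)"

definition fourier_coeff :: "(real \<Rightarrow> complex) \<Rightarrow> int \<Rightarrow> complex" where
  "fourier_coeff f k = (LINT x:{-pi..pi}|lebesgue. f x * expi (- k) x) / (2 * of_real pi)"

definition wiener_norm :: "ennreal \<Rightarrow> real \<Rightarrow> (real \<Rightarrow> complex) \<Rightarrow> ennreal" where
  "wiener_norm q \<alpha> f =
     lp_norm q (\<lambda>k. of_real ((1 + \<bar>of_int k\<bar>) powr \<alpha>) * fourier_coeff f k)"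

definition wiener_space :: "ennreal \<Rightarrow> real \<Rightarrow> (real \<Rightarrow> complex) set" where
  "wiener_space q \<alpha> = {f \<in> L1_torus. wiener_norm q \<alpha> f < top}"

definition D_set :: "nat \<Rightarrow> int set" where
  "D_set j = {k. - (2 powi (int j - 1)) \<le> (of_int k :: real) \<and> (of_int k :: real) < 2 powi (int j - 1)}"

definition trig_poly :: "nat \<Rightarrow> (real \<Rightarrow> complex) set" where
  "trig_poly j = {g. \<exists>c :: int \<Rightarrow> complex. g = (\<lambda>x. \<Sum>k\<in>D_set j. c k * expi k x)}"

definition iter_deriv :: "nat \<Rightarrow> (real \<Rightarrow> complex) \<Rightarrow> real \<Rightarrow> complex" where
  "iter_deriv n = (\<lambda>g x. vector_derivative g (at x)) ^^ n"

definition test_functions :: "(real \<Rightarrow> complex) set" where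
  "test_functions = {g. periodic2pi g \<and> (\<forall>n x. iter_deriv n g differentiable (at x))}"

text \<open>
  Complex-linear functionals on \<open>C\<^sup>\<infinity>\<close> of the torus that are continuous for the Frechet topology
  given by the seminorms \<open>g \<mapsto> sup \<bar>g\<^sup>(\<^sup>i\<^sup>)\<bar>\<close>. Values outside
  \<^const>\<open>test_functions\<close> are irrelevant.
\<close>
definition periodic_distribution :: "((real \<Rightarrow> complex) \<Rightarrow> complex) set" where
  "periodic_distribution = {T.
     (\<forall>g\<in>test_functions. \<forall>h\<in>test_functions. T (\<lambda>x. g x + h x) = T g + T h) \<and>
     (\<forall>c. \<forall>g\<in>test_functions. T (\<lambda>x. c * g x) = c * T g) \<and>
     (\<exists>C m. \<forall>g\<in>test_functions. norm (T g) \<le> C * (\<Sum>i\<le>m. SUP x. norm (iter_deriv i g x)))}"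

text \<open>
  A function \<open>f\<close> in \<open>L\<^sub>1\<close> acts as \<open>g \<mapsto> \<integral> f g\<close> over one period, so that the following
  agrees with \<^const>\<open>fourier_coeff\<close> on functions.
\<close>
definition dist_coeff :: "((real \<Rightarrow> complex) \<Rightarrow> complex) \<Rightarrow> int \<Rightarrow> complex" where
  "dist_coeff T k = T (expi (- k)) / (2 * of_real pi)"

definition amalgam_norm :: "ennreal \<Rightarrow> nat \<Rightarrow> ((real \<Rightarrow> complex) \<Rightarrow> complex) \<Rightarrow> ennreal" where
  "amalgam_norm r j \<psi> =
     (if r = top then (SUP k. ennreal (norm (dist_coeff \<psi> k)))
      else (SUP l\<in>D_set j. lp_norm r (\<lambda>\<mu>. dist_coeff \<psi> (l + 2 ^ j * \<mu>))))"

definition conv_dist :: "(real \<Rightarrow> complex) \<Rightarrow> ((real \<Rightarrow> complex) \<Rightarrow> complex) \<Rightarrow> real \<Rightarrow> complex" where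
  "conv_dist f T x = (\<Sum>\<^sub>\<infinity>\<nu>\<in>UNIV. fourier_coeff f \<nu> * dist_coeff T \<nu> * expi \<nu> x)"

definition node :: "nat \<Rightarrow> int \<Rightarrow> real" where
  "node j k = pi * of_int k / 2 powi (int j - 1)"

definition quasi_interp ::
  "nat \<Rightarrow> (real \<Rightarrow> complex) \<Rightarrow> (real \<Rightarrow> complex) \<Rightarrow> ((real \<Rightarrow> complex) \<Rightarrow> complex) \<Rightarrow> real \<Rightarrow> complex"
where
  "quasi_interp j f \<phi> T x =
     (\<Sum>k\<in>D_set j. conv_dist f T (node j k) * \<phi> (x - node j k)) / 2 ^ j"

end

theory Submission
  imports Defs
begin

text \<open>
  Sampling at the \<open>2\<^sup>j\<close> nodes folds frequencies modulo \<open>2\<^sup>j\<close>, so the \<open>k\<close>-th Fourier coefficient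
  of the error is that of \<open>f\<close> for \<open>k\<close> outside \<open>D\<^sub>j\<close>, while for \<open>k\<close> in \<open>D\<^sub>j\<close> it is the sum of a
  multiplier term, controlled by the compatibility of \<open>\<phi>\<^sub>j\<close> with its dual, and an aliasing term, a sum
  over the frequencies \<open>k + 2\<^sup>j \<mu>\<close> with \<open>\<mu> \<noteq> 0\<close>. Hoelder's inequality bounds the aliasing term by the
  weighted \<open>l\<^sub>q\<close> norm of the coefficients of \<open>f\<close> on the residue class of \<open>k\<close>, times
  the \<open>l\<^sub>q\<^sub>'\<close> norm of \<open>(1 + \<bar>k + 2\<^sup>j \<mu>\<bar>)\<^sup>-\<^sup>\<alpha>\<close> times the dual coefficient.
  Either of the conditions (i), (ii) makes the latter norm \<open>O(2\<^sup>-\<^sup>j\<^sup>\<alpha>)\<close>, and the residue classes partition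
  \<open>\<int>\<close>, so that their \<open>l\<^sub>q\<close> norms recombine to the norm of \<open>f\<close>.
\<close>

subsection \<open>Sequence norms\<close>

lemma lp_norm_top_le_iff:
  assumes "0 \<le> B"
  shows "lp_norm top a \<le> ennreal B \<longleftrightarrow> (\<forall>k. norm (a k) \<le> B)"
  using assms by (simp add: lp_norm_def SUP_le_iff ennreal_le_iff)

text \<open>Both directions raise to a power, \<open>p\<close> or \<open>1 / p\<close>; an infinite
  \<open>x\<close> violates both sides. This moves the outer root of the norm onto the
  bound.\<close>

lemma ennpow_inverse_le_iff:
  assumes "0 < p" "0 \<le> B"
  shows "ennpow x (1 / p) \<le> ennreal B \<longleftrightarrow> x \<le> ennreal (B powr p)"
proof (cases x)
  case (real r)
  have "r powr (1 / p) \<le> B \<longleftrightarrow> r \<le> B powr p"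
  proof
    assume "r powr (1 / p) \<le> B"
    then have "(r powr (1 / p)) powr p \<le> B powr p"
      using assms by (intro powr_mono2) auto
    then show "r \<le> B powr p" using assms real by (simp add: powr_powr)
  next
    assume "r \<le> B powr p"
    then have "r powr (1 / p) \<le> (B powr p) powr (1 / p)"
      using assms real by (intro powr_mono2) auto
    then show "r powr (1 / p) \<le> B" using assms by (simp add: powr_powr)
  qed
  with real assms show ?thesis by (simp add: ennpow_def)
next
  case top
  then show ?thesis by (simp add: ennpow_def top_unique)
qed

text \<open>A sum of nonnegative extended reals is the supremum of its finite partial sums. Norm
  bounds thereby become bounds on finite real sums, which need no summability argument.\<close>

lemma lp_norm_real_le_iff:
  assumes "0 < p" "0 \<le> B"
  shows "lp_norm (ennreal p) a \<le> ennreal B \<longleftrightarrow>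
    (\<forall>F. finite F \<longrightarrow> (\<Sum>k\<in>F. norm (a k) powr p) \<le> B powr p)"
proof -
  have "lp_norm (ennreal p) a =
      ennpow (SUP F\<in>{F. finite F \<and> F \<subseteq> UNIV}. \<Sum>k\<in>F. ennreal (norm (a k) powr p)) (1 / p)"
    using assms by (simp add: lp_norm_def nonneg_infsum_complete)
  then show ?thesis
    by (simp only: ennpow_inverse_le_iff[OF assms])
      (auto simp add: SUP_le_iff sum_ennreal ennreal_le_iff)
qed

section \<open>Exponents and their conjugates\<close>

lemma exponent_real_or_top:
  fixes q :: ennreal
  assumes "1 \<le> q"
  obtains "q = top" | p where "1 \<le> p" "q = ennreal p"
  using assms by (cases q) (auto simp: ennreal_le_iff simp flip: ennreal_1)

lemma inverse_ennreal_eq_1D: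
  fixes x :: ennreal
  assumes "inverse x = 1"
  shows "x = 1"
proof (cases x)
  case (real r)
  then have "r > 0" using assms by (cases "r = 0") auto
  then have "inverse r = 1"
    using assms real by (simp add: inverse_ennreal)
  then show ?thesis using real by simp
next
  case top
  then show ?thesis using assms by simp
qed

text \<open>Reduces conjugacy in \<open>ennreal\<close> to the two endpoint pairs and the interior
  case with real exponents, where Young's inequality is available.\<close>

lemma conjugate_exponent_cases:
  fixes q q' :: ennreal
  assumes "1 \<le> q" and "1 / q + 1 / q' = 1"
  obtains "q = top" "q' = ennreal 1" | "q = ennreal 1" "q' = top"
  | p p' where "1 < p" "1 < p'" "1 / p + 1 / p' = 1" "q = ennreal p" "q' = ennreal p'"
proof -
  \<comment> \<open>In \<open>ennreal\<close> the quotient \<open>1 / 0\<close> is infinite, so the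
    sum could not be 1.\<close>
  have q': "q' \<noteq> 0" using assms by (auto simp: divide_ennreal_def)
  show ?thesis
  proof (cases q)
    case top
    then have "inverse q' = 1" using assms(2) by (simp add: divide_ennreal_def)
    then have "q' = 1" by (rule inverse_ennreal_eq_1D)
    with top that show ?thesis by simp
  next
    case (real p)
    then have p: "p \<ge> 1" using assms(1) by (simp flip: ennreal_1 add: ennreal_le_iff)
    show ?thesis
    proof (cases q')
      case top
      then have "inverse q = 1" using assms(2) by (simp add: divide_ennreal_def)
      then have "q = 1" by (rule inverse_ennreal_eq_1D)
      with top that show ?thesis by simp
    next
      case (real p')
      then have p': "p' > 0" using q' by (cases "p' = 0") auto
      have "ennreal (1 / p + 1 / p') = ennreal 1"
        using assms(2) p p' \<open>q = ennreal p\<close> real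
        by (simp add: divide_ennreal ennreal_plus flip: ennreal_1)
      then have e: "1 / p + 1 / p' = 1" using p p' by (subst (asm) ennreal_inj) auto
      have "1 / p' > 0" using p' by simp
      then have "1 / p < 1" using e by linarith
      then have "1 < p" using p by (simp add: divide_simps split: if_splits)
      have "1 / p > 0" using p by simp
      then have "1 / p' < 1" using e by linarith
      then have "1 < p'" using p' by (simp add: divide_simps split: if_splits)
      with \<open>1 < p\<close> e that \<open>q = ennreal p\<close> real show ?thesis by blast
    qed
  qed
qed

lemma conjugate_exponent_ge_1:
  fixes q q' :: ennreal
  assumes "1 \<le> q" and "1 / q + 1 / q' = 1"
  shows "1 \<le> q'"
  using assms by (rule conjugate_exponent_cases) (auto simp: ennreal_le_iff simp flip: ennreal_1)

lemma lp_norm_mono_scale: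
  assumes "1 \<le> q" "0 \<le> c" "0 \<le> B" "lp_norm q b \<le> ennreal B"
    and le: "\<And>k. norm (a k) \<le> c * norm (b k)"
  shows "lp_norm q a \<le> ennreal (c * B)"
  using assms(1)
proof (cases rule: exponent_real_or_top)
  case 1
  have "norm (a k) \<le> c * B" for k
    using assms order_trans[OF le[of k] mult_left_mono[of "norm (b k)" B c]]
    by (simp add: 1 lp_norm_top_le_iff)
  then show ?thesis using assms by (simp add: 1 lp_norm_top_le_iff)
next
  case (2 p)
  have "(\<Sum>k\<in>F. norm (a k) powr p) \<le> (c * B) powr p" if "finite F" for F
  proof -
    have "(\<Sum>k\<in>F. norm (a k) powr p) \<le> (\<Sum>k\<in>F. (c * norm (b k)) powr p)"
      using 2 le by (intro sum_mono powr_mono2) auto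
    also have "\<dots> = c powr p * (\<Sum>k\<in>F. norm (b k) powr p)"
      using assms by (simp add: powr_mult sum_distrib_left)
    also have "\<dots> \<le> c powr p * B powr p"
      using assms 2 that by (intro mult_left_mono) (auto simp: lp_norm_real_le_iff)
    finally show ?thesis using assms by (simp add: powr_mult)
  qed
  then show ?thesis using assms 2 by (simp add: lp_norm_real_le_iff)
qed

text \<open>
  The constant 4, in place of the 2 that Minkowski's inequality gives, comes from the cruder
  \<open>(x + y)\<^sup>p \<le> 2\<^sup>p (x\<^sup>p + y\<^sup>p)\<close>.
\<close>
lemma lp_norm_add_le:
  assumes "1 \<le> q" "0 \<le> c" "0 \<le> A" "lp_norm q u \<le> ennreal A" "lp_norm q t \<le> ennreal A"
    and le: "\<And>k. norm (e k) \<le> c * (norm (u k) + norm (t k))"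
  shows "lp_norm q e \<le> ennreal (4 * c * A)"
  using assms(1)
proof (cases rule: exponent_real_or_top)
  case 1
  have "norm (e k) \<le> 4 * c * A" for k
  proof -
    have "norm (u k) + norm (t k) \<le> 4 * A"
      using assms(3-5) by (auto simp: 1 lp_norm_top_le_iff intro: order_trans[OF add_mono, of _ A _ A])
    then have "c * (norm (u k) + norm (t k)) \<le> c * (4 * A)"
      using assms(2) by (rule mult_left_mono)
    with le[of k] show ?thesis by simp
  qed
  then show ?thesis using assms by (simp add: 1 lp_norm_top_le_iff)
next
  case (2 p)
  have "(\<Sum>k\<in>F. norm (e k) powr p) \<le> (4 * c * A) powr p" if "finite F" for F
  proof -
    have "norm (e k) powr p \<le> (2 * c) powr p * (norm (u k) powr p + norm (t k) powr p)" for k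
    proof -
      have "norm (u k) + norm (t k) \<le> 2 * max (norm (u k)) (norm (t k))" by simp
      then have "c * (norm (u k) + norm (t k)) \<le> c * (2 * max (norm (u k)) (norm (t k)))"
        using assms(2) by (rule mult_left_mono)
      with le[of k] have "norm (e k) \<le> (2 * c) * max (norm (u k)) (norm (t k))" by simp
      then have "norm (e k) powr p \<le> ((2 * c) * max (norm (u k)) (norm (t k))) powr p"
        using 2 by (intro powr_mono2) auto
      also have "\<dots> = (2 * c) powr p * max (norm (u k)) (norm (t k)) powr p"
        using assms(2) by (simp add: powr_mult)
      also have "\<dots> \<le> (2 * c) powr p * (norm (u k) powr p + norm (t k) powr p)"
        by (intro mult_left_mono) (auto simp: max_def)
      finally show ?thesis .
    qed
    then have "(\<Sum>k\<in>F. norm (e k) powr p) \<le>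
        (\<Sum>k\<in>F. (2 * c) powr p * (norm (u k) powr p + norm (t k) powr p))"
      by (rule sum_mono)
    also have "\<dots> = (2 * c) powr p * ((\<Sum>k\<in>F. norm (u k) powr p) + (\<Sum>k\<in>F. norm (t k) powr p))"
      by (simp only: sum_distrib_left[symmetric] sum.distrib)
    also have "\<dots> \<le> (2 * c) powr p * (A powr p + A powr p)"
      using assms 2 that by (intro mult_left_mono add_mono) (auto simp: lp_norm_real_le_iff)
    also have "\<dots> \<le> (2 * c) powr p * (2 powr p * A powr p)"
    proof (intro mult_left_mono)
      have "(2::real) powr 1 \<le> 2 powr p" using 2 by (intro powr_mono) auto
      then show "A powr p + A powr p \<le> 2 powr p * A powr p"
        using mult_right_mono[of 2 "2 powr p" "A powr p"] by simp
    qed simp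
    also have "\<dots> = (4 * c * A) powr p"
      using assms by (simp flip: powr_mult add: mult_ac)
    finally show ?thesis .
  qed
  then show ?thesis using assms 2 by (simp add: lp_norm_real_le_iff)
qed

text \<open>Young's inequality for the normalised factors, summed over \<open>F\<close>: each
  normalised power sum is at most 1, and \<open>1 / p + 1 / p' = 1\<close>.\<close>

lemma lp_norm_Hoelder_real:
  fixes a b :: "int \<Rightarrow> complex"
  assumes p: "1 < p" "1 < p'" "1 / p + 1 / p' = 1" and "finite F" "0 < A" "0 < B"
    and "(\<Sum>k\<in>F. norm (a k) powr p) \<le> A powr p" "(\<Sum>k\<in>F. norm (b k) powr p') \<le> B powr p'"
  shows "(\<Sum>k\<in>F. norm (a k) * norm (b k)) \<le> A * B"
proof -
  have "(norm (a k) / A) * (norm (b k) / B) \<le>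
      (norm (a k) / A) powr p / p + (norm (b k) / B) powr p' / p'" for k
    using assms by (intro Youngs_inequality) auto
  then have "(\<Sum>k\<in>F. (norm (a k) / A) * (norm (b k) / B)) \<le>
      (\<Sum>k\<in>F. (norm (a k) / A) powr p / p + (norm (b k) / B) powr p' / p')"
    by (rule sum_mono)
  also have "\<dots> = (\<Sum>k\<in>F. norm (a k) powr p) / A powr p / p + (\<Sum>k\<in>F. norm (b k) powr p') / B powr p' / p'"
    using assms by (simp add: powr_divide sum.distrib sum_divide_distrib)
  also have "\<dots> \<le> 1 / p + 1 / p'"
    using assms by (intro add_mono divide_right_mono) (auto simp: divide_le_eq)
  finally have "(\<Sum>k\<in>F. norm (a k) * norm (b k)) / (A * B) \<le> 1"
    using p by (simp add: sum_divide_distrib)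
  then show ?thesis using assms by (simp add: divide_le_eq)
qed

text \<open>
  Enlarging both bounds by \<open>\<epsilon>\<close> makes the normalising constants of the previous lemma positive.
\<close>
lemma lp_norm_Hoelder:
  assumes "1 \<le> q" "1 / q + 1 / q' = 1" "0 \<le> A" "0 \<le> B"
    and a: "lp_norm q a \<le> ennreal A" and b: "lp_norm q' b \<le> ennreal B" and "finite F"
  shows "(\<Sum>k\<in>F. norm (a k) * norm (b k)) \<le> A * B"
  using assms(1,2)
proof (cases rule: conjugate_exponent_cases)
  case 1
  have "(\<Sum>k\<in>F. norm (a k) * norm (b k)) \<le> (\<Sum>k\<in>F. A * norm (b k))"
    using a 1 assms by (intro sum_mono mult_right_mono) (auto simp: lp_norm_top_le_iff)
  also have "\<dots> \<le> A * B"
  proof -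
    have "(\<Sum>k\<in>F. norm (b k)) \<le> B"
      using b assms unfolding 1 by (subst (asm) lp_norm_real_le_iff) auto
    then show ?thesis using assms by (simp flip: sum_distrib_left add: mult_left_mono)
  qed
  finally show ?thesis .
next
  case 2
  have "(\<Sum>k\<in>F. norm (a k) * norm (b k)) \<le> (\<Sum>k\<in>F. norm (a k) * B)"
    using b 2 assms by (intro sum_mono mult_left_mono) (auto simp: lp_norm_top_le_iff)
  also have "\<dots> \<le> A * B"
  proof -
    have "(\<Sum>k\<in>F. norm (a k)) \<le> A"
      using a assms unfolding 2 by (subst (asm) lp_norm_real_le_iff) auto
    then show ?thesis using assms by (simp flip: sum_distrib_right add: mult_right_mono)
  qed
  finally show ?thesis .
next
  case (3 p p')
  have "(\<Sum>k\<in>F. norm (a k) * norm (b k)) \<le> (A + \<epsilon>) * (B + \<epsilon>)" if "\<epsilon> > 0" for \<epsilon>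
  proof (rule lp_norm_Hoelder_real)
    have "A powr p \<le> (A + \<epsilon>) powr p" "B powr p' \<le> (B + \<epsilon>) powr p'"
      using 3 that assms by (auto intro!: powr_mono2)
    then show "(\<Sum>k\<in>F. norm (a k) powr p) \<le> (A + \<epsilon>) powr p" "(\<Sum>k\<in>F. norm (b k) powr p') \<le> (B + \<epsilon>) powr p'"
      using a b assms 3 by (auto simp: lp_norm_real_le_iff intro: order_trans)
  qed (use 3 assms that in auto)
  \<comment> \<open>The left side does not depend on \<epsilon>, so letting \<epsilon> tend to 0
    from the right recovers the bound \<open>A * B\<close>.\<close>
  then have "\<forall>\<^sub>F \<epsilon> in at_right 0. (\<Sum>k\<in>F. norm (a k) * norm (b k)) \<le> (A + \<epsilon>) * (B + \<epsilon>)"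
    by (auto simp: eventually_at_right_field intro: exI[of _ 1])
  moreover have "((\<lambda>\<epsilon>. (A + \<epsilon>) * (B + \<epsilon>)) \<longlongrightarrow> (A + 0) * (B + 0)) (at_right 0)"
    by (intro tendsto_intros)
  ultimately show ?thesis
    using tendsto_lowerbound[of _ "A * B" "at_right (0::real)"] by simp
qed

text \<open>The finite form is uniform in \<open>F\<close>. The absolute summability obtained here
  later justifies regrouping the convolution series by residue classes.\<close>

lemma lp_norm_Hoelder_infsum:
  assumes "1 \<le> q" "1 / q + 1 / q' = 1" "0 \<le> A" "0 \<le> B"
    and "lp_norm q a \<le> ennreal A" "lp_norm q' b \<le> ennreal B"
  shows "(\<lambda>k. norm (a k * b k)) summable_on UNIV" and "norm (\<Sum>\<^sub>\<infinity>k. a k * b k) \<le> A * B"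
proof -
  have bd: "(\<Sum>k\<in>F. norm (a k * b k)) \<le> A * B" if "finite F" for F
    using lp_norm_Hoelder[OF assms that] by (simp add: norm_mult)
  then show s: "(\<lambda>k. norm (a k * b k)) summable_on UNIV"
    by (intro nonneg_bdd_above_summable_on) (auto intro: bdd_aboveI2[where M = "A * B"])
  show "norm (\<Sum>\<^sub>\<infinity>k. a k * b k) \<le> A * B"
    using norm_infsum_bound[OF s] infsum_le_finite_sums[OF s bd] by simp
qed

subsection \<open>Residue classes and nodes\<close>

text \<open>The upper end is not simply \<open>2 ^ j div 2\<close> because of \<open>j = 0\<close>:
  the real bounds are then plus and minus one half, the set is \<open>{0}\<close>, and
  \<open>2 ^ 0 div 2\<close> is 0. In this form there are \<open>2 ^ j\<close> integers for every
  \<open>j\<close>.\<close>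

lemma D_set_eq: "D_set j = {- (2 ^ j div 2)..<2 ^ j - 2 ^ j div 2}"
proof (cases j)
  case 0
  have iff: "- (1 / 2) \<le> (of_int k :: real) \<and> (of_int k :: real) < 1 / 2 \<longleftrightarrow> k = 0" for k
    by linarith
  have pow: "(2::real) powi (int 0 - 1) = 1 / 2" by (simp add: power_int_minus)
  have "D_set 0 = {0}" by (simp only: D_set_def pow iff) simp
  also have "{0} = {- (2 ^ 0 div 2)..<2 ^ 0 - 2 ^ 0 div 2 :: int}" by auto
  finally show ?thesis by (simp only: 0)
next
  case (Suc n)
  have le: "- (2 ^ n) \<le> (of_int k :: real) \<longleftrightarrow> - (2 ^ n) \<le> k" for k
  proof -
    have "- (2 ^ n) \<le> (of_int k :: real) \<longleftrightarrow> of_int (- (2 ^ n)) \<le> (of_int k :: real)" by simp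
    then show ?thesis by (simp only: of_int_le_iff)
  qed
  have less: "(of_int k :: real) < 2 ^ n \<longleftrightarrow> k < 2 ^ n" for k
  proof -
    have "(of_int k :: real) < 2 ^ n \<longleftrightarrow> of_int k < (of_int (2 ^ n) :: real)" by simp
    then show ?thesis by (simp only: of_int_less_iff)
  qed
  have pow: "(2::real) powi (int (Suc n) - 1) = 2 ^ n" by simp
  have "D_set (Suc n) = {- (2 ^ n)..<2 ^ n}"
    by (simp only: D_set_def pow le less) (simp only: set_eq_iff atLeastLessThan_iff mem_Collect_eq simp_thms)
  also have "\<dots> = {- (2 ^ Suc n div 2)..<2 ^ Suc n - 2 ^ Suc n div 2}" by simp
  finally show ?thesis by (simp only: Suc)
qed

lemma finite_D_set [simp]: "finite (D_set j)"
  by (simp add: D_set_eq)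

text \<open>The factor 2 stands at the frequency because half of \<open>2 ^ j\<close> is not an
  integer for \<open>j = 0\<close>.\<close>

lemma abs_D_set_le:
  assumes "k \<in> D_set j"
  shows "2 * \<bar>k\<bar> \<le> 2 ^ j"
  using assms by (auto simp: D_set_eq)

lemma abs_not_D_set_ge:
  assumes "k \<notin> D_set j"
  shows "2 ^ j \<le> 2 * \<bar>k\<bar>"
  using assms by (cases j) (auto simp: D_set_eq)

text \<open>Makes distinct frequencies of \<open>D_set j\<close> incongruent modulo
  \<open>2 ^ j\<close>, as discrete orthogonality requires.\<close>

lemma D_set_diff_lt:
  assumes "k \<in> D_set j" "l \<in> D_set j"
  shows "\<bar>k - l\<bar> < 2 ^ j"
  using assms by (auto simp: D_set_eq)

text \<open>\<open>D_set j\<close> is a complete system of residues modulo \<open>2 ^ j\<close>. The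
  inverse is division with remainder after a shift by \<open>?h\<close>, which carries
  \<open>D_set j\<close> to the standard residues starting at 0.\<close>

lemma bij_betw_D_set_blocks: "bij_betw (\<lambda>(k, \<mu>). k + 2 ^ j * \<mu>) (D_set j \<times> UNIV) UNIV"
proof (rule bij_betw_byWitness)
  let ?h = "2 ^ j div 2 :: int"
  let ?g = "\<lambda>\<nu>. ((\<nu> + ?h) mod 2 ^ j - ?h, (\<nu> + ?h) div 2 ^ j)"
  show "\<forall>a\<in>D_set j \<times> UNIV. ?g ((\<lambda>(k, \<mu>). k + 2 ^ j * \<mu>) a) = a"
  proof
    fix a :: "int \<times> int" assume "a \<in> D_set j \<times> UNIV"
    then obtain k \<mu> where a: "a = (k, \<mu>)" and k: "k \<in> D_set j" by auto
    have eq: "k + 2 ^ j * \<mu> + ?h = (k + ?h) + \<mu> * 2 ^ j" by (simp add: algebra_simps)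
    have "0 \<le> k + ?h" "k + ?h < 2 ^ j" using k by (auto simp: D_set_eq)
    then have "((k + ?h) + \<mu> * 2 ^ j) mod 2 ^ j = k + ?h" "((k + ?h) + \<mu> * 2 ^ j) div 2 ^ j = \<mu>"
      by simp_all
    then show "?g ((\<lambda>(k, \<mu>). k + 2 ^ j * \<mu>) a) = a" unfolding a prod.case eq by simp
  qed
  have "(\<nu> + ?h) mod 2 ^ j + 2 ^ j * ((\<nu> + ?h) div 2 ^ j) = \<nu> + ?h" for \<nu>
    by (rule mod_mult_div_eq)
  then have "(\<nu> + ?h) mod 2 ^ j - ?h + 2 ^ j * ((\<nu> + ?h) div 2 ^ j) = \<nu>" for \<nu>
    by (simp add: diff_add_eq)
  then show "\<forall>\<nu>\<in>UNIV. (\<lambda>(k, \<mu>). k + 2 ^ j * \<mu>) (?g \<nu>) = \<nu>"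
    by simp
  have "(\<nu> + ?h) mod 2 ^ j - ?h \<in> D_set j" for \<nu>
    by (simp add: D_set_eq)
  then show "?g ` UNIV \<subseteq> D_set j \<times> UNIV" by auto
qed simp

lemma infsum_D_set_blocks:
  fixes g :: "int \<Rightarrow> 'a::banach"
  assumes "g summable_on UNIV"
  shows "(\<Sum>\<^sub>\<infinity>\<nu>. g \<nu>) = (\<Sum>l\<in>D_set j. \<Sum>\<^sub>\<infinity>\<mu>. g (l + 2 ^ j * \<mu>))"
proof -
  have "(\<lambda>x. g ((\<lambda>(k, \<mu>). k + 2 ^ j * \<mu>) x)) summable_on (D_set j \<times> UNIV)"
    using assms by (subst summable_on_reindex_bij_betw[OF bij_betw_D_set_blocks])
  then have s: "(\<lambda>(k, \<mu>). g (k + 2 ^ j * \<mu>)) summable_on (D_set j \<times> UNIV)"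
    by (simp add: case_prod_unfold)
  have "(\<Sum>\<^sub>\<infinity>\<nu>. g \<nu>) = infsum (\<lambda>x. g ((\<lambda>(k, \<mu>). k + 2 ^ j * \<mu>) x)) (D_set j \<times> UNIV)"
    by (rule infsum_reindex_bij_betw[OF bij_betw_D_set_blocks, symmetric])
  also have "\<dots> = infsum (\<lambda>(k, \<mu>). g (k + 2 ^ j * \<mu>)) (D_set j \<times> UNIV)"
    by (simp add: case_prod_unfold)
  also have "\<dots> = (\<Sum>\<^sub>\<infinity>l\<in>D_set j. \<Sum>\<^sub>\<infinity>\<mu>. g (l + 2 ^ j * \<mu>))"
    by (rule infsum_Sigma'_banach[OF s, symmetric])
  finally show ?thesis by simp
qed

text \<open>There are only finitely many residue classes, so absolute summability on each of them
  suffices.\<close>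

lemma norm_summable_D_set_blocks:
  fixes g :: "int \<Rightarrow> 'a::real_normed_vector"
  assumes "\<And>l. l \<in> D_set j \<Longrightarrow> (\<lambda>\<mu>. norm (g (l + 2 ^ j * \<mu>))) summable_on UNIV"
  shows "(\<lambda>\<nu>. norm (g \<nu>)) summable_on UNIV"
proof -
  have "(\<lambda>x. norm ((\<lambda>(k, \<mu>). g (k + 2 ^ j * \<mu>)) x)) summable_on (D_set j \<times> UNIV)"
    by (rule iffD2[OF Infinite_Sum.abs_summable_on_Sigma_iff]) (simp add: assms)
  then have "(\<lambda>x. norm (g ((\<lambda>(k, \<mu>). k + 2 ^ j * \<mu>) x))) summable_on (D_set j \<times> UNIV)"
    by (simp add: case_prod_unfold)
  then show ?thesis
    by (subst (asm) summable_on_reindex_bij_betw[OF bij_betw_D_set_blocks])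
qed

lemma summable_lp_norm_powr:
  assumes "1 \<le> p" "0 \<le> A" "lp_norm (ennreal p) u \<le> ennreal A"
  shows "(\<lambda>k. norm (u k) powr p) summable_on UNIV" "(\<Sum>\<^sub>\<infinity>k. norm (u k) powr p) \<le> A powr p"
proof -
  have bd: "(\<Sum>k\<in>F. norm (u k) powr p) \<le> A powr p" if "finite F" for F
    using assms that by (simp add: lp_norm_real_le_iff)
  then show s: "(\<lambda>k. norm (u k) powr p) summable_on UNIV"
    by (intro nonneg_bdd_above_summable_on) (auto intro: bdd_aboveI2[where M = "A powr p"])
  show "(\<Sum>\<^sub>\<infinity>k. norm (u k) powr p) \<le> A powr p"
    using infsum_le_finite_sums[OF s bd] by simp
qed

text \<open>For finite \<open>q\<close>, \<open>T k\<close> is the norm of \<open>u\<close> along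
  the residue class of \<open>k\<close>. Restricting \<open>T\<close> to \<open>D_set j\<close>
  counts each class once, so the \<open>q\<close>-th powers add up to the full sum for
  \<open>u\<close>.\<close>

lemma lp_norm_blocks:
  assumes "1 \<le> q" "0 \<le> A" and u: "lp_norm q u \<le> ennreal A"
  obtains T :: "int \<Rightarrow> real" where "\<And>k. 0 \<le> T k"
    "\<And>k. lp_norm q (\<lambda>\<mu>. u (k + 2 ^ j * \<mu>)) \<le> ennreal (T k)"
    "lp_norm q (\<lambda>k. if k \<in> D_set j then of_real (T k) else 0) \<le> ennreal A"
  using assms(1)
proof (cases rule: exponent_real_or_top)
  case 1
  \<comment> \<open>For the supremum norm the constant \<open>A\<close> serves for every
    class.\<close>
  show ?thesis
    using assms by (intro that[of "\<lambda>_. A"]) (auto simp: 1 lp_norm_top_le_iff)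
next
  case (2 p)
  define T where "T k = (\<Sum>\<^sub>\<infinity>\<mu>. norm (u (k + 2 ^ j * \<mu>)) powr p) powr (1 / p)" for k
  have s: "(\<lambda>k. norm (u k) powr p) summable_on UNIV" and le: "(\<Sum>\<^sub>\<infinity>k. norm (u k) powr p) \<le> A powr p"
    using summable_lp_norm_powr[of p A u] 2 assms by auto
  have inj: "inj (\<lambda>\<mu>. k + 2 ^ j * \<mu> :: int)" for k
    by (auto simp: inj_on_def)
  have sb: "(\<lambda>\<mu>. norm (u (k + 2 ^ j * \<mu>)) powr p) summable_on UNIV" for k
    using summable_on_reindex[OF inj[of k], of "\<lambda>k. norm (u k) powr p"]
      summable_on_subset_banach[OF s, of "range (\<lambda>\<mu>. k + 2 ^ j * \<mu>)"]
    by (simp add: o_def)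
  have nn: "0 \<le> (\<Sum>\<^sub>\<infinity>\<mu>. norm (u (k + 2 ^ j * \<mu>)) powr p)" for k
    by (rule infsum_nonneg) simp
  have Tp: "T k powr p = (\<Sum>\<^sub>\<infinity>\<mu>. norm (u (k + 2 ^ j * \<mu>)) powr p)" for k
    using 2 nn by (simp add: T_def powr_powr)
  show ?thesis
  proof (rule that[of T])
    show "0 \<le> T k" for k by (simp add: T_def)
    show "lp_norm q (\<lambda>\<mu>. u (k + 2 ^ j * \<mu>)) \<le> ennreal (T k)" for k
    proof -
      have "(\<Sum>\<mu>\<in>F. norm (u (k + 2 ^ j * \<mu>)) powr p) \<le> T k powr p" if "finite F" for F
        unfolding Tp by (rule finite_sum_le_infsum[OF sb that]) auto
      then show ?thesis using 2 by (simp add: lp_norm_real_le_iff T_def)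
    qed
    have "(\<Sum>k\<in>F. norm (if k \<in> D_set j then complex_of_real (T k) else 0) powr p) \<le> A powr p" if "finite F" for F
    proof -
      have "(\<Sum>k\<in>F. norm (if k \<in> D_set j then complex_of_real (T k) else 0) powr p) =
          (\<Sum>k\<in>F \<inter> D_set j. T k powr p)"
        using that 2 by (intro sum.mono_neutral_cong_right) (auto simp: T_def)
      also have "\<dots> \<le> (\<Sum>k\<in>D_set j. T k powr p)"
        by (intro sum_mono2) auto
      also have "\<dots> \<le> A powr p"
        using le by (simp add: Tp infsum_D_set_blocks[OF s, of j])
      finally show ?thesis .
    qed
    then show "lp_norm q (\<lambda>k. if k \<in> D_set j then of_real (T k) else 0) \<le> ennreal A"
      using 2 assms by (simp add: lp_norm_real_le_iff)
  qed
qed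

section \<open>Exponentials at the nodes\<close>

lemma expi_add: "expi (k + l) x = expi k x * expi l x"
  by (simp add: expi_def distrib_left distrib_right exp_add)

lemma expi_diff_right: "expi k (x - y) = expi k x * expi (- k) y"
  by (simp add: expi_def algebra_simps flip: exp_add)

lemma norm_expi [simp]: "norm (expi k x) = 1"
proof -
  have "expi k x = exp (\<i> * of_real (of_int k * x))" by (simp add: expi_def mult.assoc)
  then show ?thesis by (simp only: norm_exp_i_times)
qed

lemma node_eq: "node j n = 2 * pi * of_int n / 2 ^ j"
  by (simp add: node_def power_int_diff)

text \<open>The exponent is an integer multiple of \<open>2 * pi * \<i>\<close>. This is the source
  of aliasing: frequencies congruent modulo \<open>2 ^ j\<close> agree at every node.\<close>

lemma expi_multiple_node: "expi (2 ^ j * \<mu>) (node j n) = 1"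
proof -
  have "of_int (2 ^ j * \<mu>) * node j n = of_int (2 * (\<mu> * n)) * pi"
    by (simp add: node_eq)
  then have "expi (2 ^ j * \<mu>) (node j n) = exp (\<i> * of_real (of_int (2 * (\<mu> * n)) * pi))"
    unfolding expi_def by (metis mult.assoc of_real_mult of_real_of_int_eq)
  also have "\<dots> = 1"
    by (subst exp_eq_1) (auto intro: exI[of _ "\<mu> * n"])
  finally show ?thesis .
qed

text \<open>A geometric sum over the powers of \<open>?z\<close>, a root of unity of order dividing
  \<open>2 ^ j\<close>. The bound on \<open>m\<close> excludes nonzero multiples of
  \<open>2 ^ j\<close>, so \<open>?z\<close> is 1 only for \<open>m = 0\<close>.\<close>

lemma sum_expi_node:
  assumes "\<bar>m\<bar> < 2 ^ j"
  shows "(\<Sum>n\<in>D_set j. expi m (node j n)) = (if m = 0 then 2 ^ j else 0)"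
proof -
  let ?h = "2 ^ j div 2 :: int"
  let ?z = "expi m (node j 1)"
  have D: "D_set j = (\<lambda>i. int i - ?h) ` {..<2 ^ j}"
  proof (intro set_eqI iffI)
    fix k assume "k \<in> D_set j"
    then have "0 \<le> k + ?h" "k + ?h < 2 ^ j" by (auto simp: D_set_eq)
    then show "k \<in> (\<lambda>i. int i - ?h) ` {..<2 ^ j}"
      by (intro image_eqI[of _ _ "nat (k + ?h)"]) (auto simp: nat_less_iff)
  next
    fix k assume "k \<in> (\<lambda>i. int i - ?h) ` {..<2 ^ j}"
    then obtain i where "k = int i - ?h" "i < 2 ^ j" by blast
    moreover from this have "int i < 2 ^ j" by (metis of_nat_less_iff of_nat_numeral of_nat_power)
    ultimately show "k \<in> D_set j" by (simp add: D_set_eq)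
  qed
  have inj: "inj_on (\<lambda>i. int i - ?h) {..<2 ^ j}" by (auto simp: inj_on_def)
  have pw: "expi m (node j (int i)) = ?z ^ i" for i
  proof -
    have "?z ^ i = exp (of_nat i * (\<i> * of_int m * of_real (node j 1)))"
      unfolding expi_def by (rule exp_of_nat_mult[symmetric])
    moreover have "of_nat i * (\<i> * of_int m * of_real (node j 1)) = \<i> * of_int m * of_real (node j (int i))"
      by (simp add: node_eq)
    ultimately show ?thesis by (simp add: expi_def)
  qed
  \<comment> \<open>Starting the index at \<open>- ?h\<close> instead of 0 only contributes a phase
    common to all terms.\<close>
  have "expi m (node j (int i - ?h)) = ?z ^ i * expi (- m) (node j ?h)" for i
  proof -
    have "node j (int i - ?h) = node j (int i) - node j ?h" by (simp add: node_eq diff_divide_distrib right_diff_distrib)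
    then show ?thesis by (simp only: expi_diff_right pw)
  qed
  then have S: "(\<Sum>n\<in>D_set j. expi m (node j n)) = (\<Sum>i<2 ^ j. ?z ^ i) * expi (- m) (node j ?h)"
    by (simp add: D sum.reindex[OF inj] sum_distrib_right)
  show ?thesis
  proof (cases "m = 0")
    case True
    then show ?thesis unfolding S by (simp add: expi_def)
  next
    case False
    have "?z \<noteq> 1"
    proof
      assume "?z = 1"
      then obtain n :: int where "of_int m * (2 * pi / 2 ^ j) = of_int (2 * n) * pi"
        by (auto simp: expi_def node_eq exp_eq_1)
      then have "of_int m = (of_int (n * 2 ^ j) :: real)" by (simp add: field_simps)
      then have "m = n * 2 ^ j" by linarith
      with assms False show False by (auto simp: abs_mult mult_less_cancel_right2)
    qed
    moreover have "?z ^ (2 ^ j) = 1"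
    proof -
      have "?z ^ (2 ^ j) = expi m (node j (2 ^ j))"
        using pw[of "2 ^ j"] by simp
      also have "\<dots> = expi (2 ^ j * m) (node j 1)"
        by (simp add: expi_def node_eq mult.assoc)
      finally show ?thesis by (simp only: expi_multiple_node)
    qed
    ultimately have "(\<Sum>i<2 ^ j. ?z ^ i) = 0"
      using geometric_sum[of ?z "2 ^ j"] by simp
    then show ?thesis unfolding S using False by simp
  qed
qed

subsection \<open>Fourier coefficients of the quasi-interpolant\<close>

lemma continuous_on_expi [continuous_intros]: "continuous_on S (expi k)"
  unfolding expi_def by (intro continuous_intros)

lemma expi_integrable: "expi k absolutely_integrable_on {-pi..pi}"
  by (intro absolutely_integrable_continuous_real continuous_intros)

lemma integral_expi: "(LINT x:{-pi..pi}|lebesgue. expi k x) = (if k = 0 then 2 * of_real pi else 0)"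
proof -
  have "(expi k has_integral (if k = 0 then 2 * of_real pi else 0)) {-pi..pi}"
  proof (cases "k = 0")
    case True
    have "((\<lambda>x. 1 :: complex) has_integral (of_real (pi - (- pi)))) {-pi..pi}"
      using has_integral_const_real[of "1::complex" "-pi" pi] by (simp add: scaleR_conv_of_real)
    moreover have "expi k = (\<lambda>x. 1)" using True by (simp add: expi_def fun_eq_iff)
    ultimately show ?thesis using True by simp
  next
    case False
    let ?F = "\<lambda>x. expi k x / (\<i> * of_int k)"
    have "(expi k has_integral (?F pi - ?F (- pi))) {-pi..pi}"
    proof (rule fundamental_theorem_of_calculus)
      fix x
      have "((\<lambda>z. exp (\<i> * of_int k * z) / (\<i> * of_int k)) has_field_derivative expi k x) (at (of_real x))"
        using False by (auto intro!: derivative_eq_intros simp: expi_def)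
      from has_vector_derivative_real_field[OF this]
      show "(?F has_vector_derivative expi k x) (at x within {-pi..pi})"
        by (simp only: expi_def)
    qed simp
    \<comment> \<open>By periodicity the antiderivative takes equal values at both
      endpoints.\<close>
    moreover have "expi k pi = expi k (- pi)"
    proof -
      have "expi (- k) (2 * pi) = 1"
      proof -
        have "expi (- k) (2 * pi) = exp (\<i> * of_real (of_int (2 * (- k)) * pi))"
          by (simp add: expi_def mult_ac)
        also have "\<dots> = 1"
          by (subst exp_eq_1) (auto intro: exI[of _ "- k"])
        finally show ?thesis .
      qed
      then show ?thesis using expi_diff_right[of k pi "2 * pi"] by simp
    qed
    ultimately show ?thesis using False by simp
  qed
  then show ?thesis
    using set_lebesgue_integral_eq_integral(2)[OF expi_integrable] by (simp add: integral_unique)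
qed

lemma mult_expi_integrable:
  assumes "f absolutely_integrable_on {-pi..pi}"
  shows "(\<lambda>x. f x * expi k x) absolutely_integrable_on {-pi..pi}"
proof -
  have "(\<lambda>x. expi k x * f x) absolutely_integrable_on {-pi..pi}"
  proof (rule absolutely_integrable_bounded_measurable_product[OF bilinear_times _ _ _ assms])
    show "expi k \<in> borel_measurable (lebesgue_on {-pi..pi})"
      by (intro continuous_imp_measurable_on_sets_lebesgue continuous_intros) simp
    show "bounded (expi k ` {-pi..pi})"
      by (auto simp: bounded_iff)
  qed simp
  then show ?thesis by (simp add: mult.commute)
qed

text \<open>Orthogonality of the exponentials over a period. It identifies the coefficients of both
  the kernel \<phi> and the quasi-interpolant.\<close>

lemma fourier_coeff_trig_poly:
  assumes "finite D"
  shows "fourier_coeff (\<lambda>x. \<Sum>k\<in>D. c k * expi k x) l = (if l \<in> D then c l else 0)"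
proof -
  have "(LINT x:{-pi..pi}|lebesgue. (\<Sum>k\<in>D. c k * expi k x) * expi (- l) x) =
      (LINT x:{-pi..pi}|lebesgue. \<Sum>k\<in>D. c k * expi (k - l) x)"
  proof -
    have "(\<Sum>k\<in>D. c k * expi k x) * expi (- l) x = (\<Sum>k\<in>D. c k * expi (k - l) x)" for x
      using expi_add[of _ "- l" x] by (simp add: sum_distrib_right mult.assoc)
    then show ?thesis by simp
  qed
  also have "\<dots> = (\<Sum>k\<in>D. LINT x:{-pi..pi}|lebesgue. c k * expi (k - l) x)"
    unfolding set_lebesgue_integral_def scaleR_sum_right
    using set_integrable_mult_right[OF expi_integrable]
    by (intro Bochner_Integration.integral_sum) (simp add: set_integrable_def)
  also have "\<dots> = (\<Sum>k\<in>D. if k = l then c l * (2 * of_real pi) else 0)"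
    by (intro sum.cong) (auto simp: integral_expi)
  also have "\<dots> = (if l \<in> D then c l * (2 * of_real pi) else 0)"
    using assms by (simp add: sum.delta')
  finally show ?thesis by (simp add: fourier_coeff_def)
qed

lemma fourier_coeff_diff:
  assumes "f absolutely_integrable_on {-pi..pi}" "g absolutely_integrable_on {-pi..pi}"
  shows "fourier_coeff (\<lambda>x. f x - g x) k = fourier_coeff f k - fourier_coeff g k"
  using assms by (simp add: fourier_coeff_def left_diff_distrib mult_expi_integrable diff_divide_distrib)

lemma trig_poly_integrable: "(\<lambda>x. \<Sum>k\<in>D. c k * expi k x) absolutely_integrable_on {-pi..pi}"
  by (intro absolutely_integrable_continuous_real continuous_intros)

text \<open>The coefficient that the samples of the convolution see at frequency \<open>l\<close>.
  Since \<open>infsum\<close> defaults to 0 for a series that is not summable, the identities using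
  it assume absolute summability.\<close>

definition aliased_coeff :: "nat \<Rightarrow> (real \<Rightarrow> complex) \<Rightarrow> ((real \<Rightarrow> complex) \<Rightarrow> complex) \<Rightarrow> int \<Rightarrow> complex"
  where "aliased_coeff j f T l = (\<Sum>\<^sub>\<infinity>\<mu>. fourier_coeff f (l + 2 ^ j * \<mu>) * dist_coeff T (l + 2 ^ j * \<mu>))"

text \<open>Regroup the absolutely convergent series by residue classes; at a node the exponential
  is constant on each class and can be pulled out.\<close>

lemma conv_dist_node:
  assumes "(\<lambda>\<nu>. norm (fourier_coeff f \<nu> * dist_coeff T \<nu>)) summable_on UNIV"
  shows "conv_dist f T (node j n) = (\<Sum>l\<in>D_set j. aliased_coeff j f T l * expi l (node j n))"
proof -
  let ?g = "\<lambda>\<nu>. fourier_coeff f \<nu> * dist_coeff T \<nu> * expi \<nu> (node j n)"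
  have "(\<lambda>\<nu>. norm (?g \<nu>)) summable_on UNIV"
    using assms by (simp add: norm_mult)
  then have "?g summable_on UNIV" by (rule abs_summable_summable)
  then have "conv_dist f T (node j n) = (\<Sum>l\<in>D_set j. \<Sum>\<^sub>\<infinity>\<mu>. ?g (l + 2 ^ j * \<mu>))"
    unfolding conv_dist_def by (rule infsum_D_set_blocks)
  also have "\<dots> = (\<Sum>l\<in>D_set j. aliased_coeff j f T l * expi l (node j n))"
    by (simp add: aliased_coeff_def expi_add expi_multiple_node infsum_cmult_left')
  finally show ?thesis .
qed

text \<open>On the nodes both factors are trigonometric polynomials with frequencies in
  \<open>D_set j\<close>. Orthogonality keeps the diagonal terms, and its factor
  \<open>2 ^ j\<close> cancels the normalisation of the operator.\<close>

lemma quasi_interp_eq: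
  assumes "(\<lambda>\<nu>. norm (fourier_coeff f \<nu> * dist_coeff T \<nu>)) summable_on UNIV"
    and "\<phi> \<in> trig_poly j"
  shows "quasi_interp j f \<phi> T =
    (\<lambda>x. \<Sum>k\<in>D_set j. (fourier_coeff \<phi> k * aliased_coeff j f T k) * expi k x)"
proof
  fix x
  let ?S = "aliased_coeff j f T" and ?c = "fourier_coeff \<phi>" and ?D = "D_set j"
  obtain c where c: "\<phi> = (\<lambda>x. \<Sum>k\<in>?D. c k * expi k x)"
    using assms(2) by (auto simp: trig_poly_def)
  then have "\<phi> y = (\<Sum>k\<in>?D. ?c k * expi k y)" for y
    by (simp add: fourier_coeff_trig_poly)
  then have "(\<Sum>n\<in>?D. conv_dist f T (node j n) * \<phi> (x - node j n)) =
      (\<Sum>n\<in>?D. (\<Sum>l\<in>?D. ?S l * expi l (node j n)) * (\<Sum>k\<in>?D. ?c k * expi k (x - node j n)))"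
    by (simp only: conv_dist_node[OF assms(1)])
  also have "\<dots> = (\<Sum>n\<in>?D. \<Sum>l\<in>?D. \<Sum>k\<in>?D. (?S l * ?c k * expi k x) * expi (l - k) (node j n))"
  proof -
    have "?S l * expi l y * (?c k * expi k (x - y)) = (?S l * ?c k * expi k x) * expi (l - k) y" for l k y
      using expi_add[of l "- k" y] by (simp add: expi_diff_right)
    then show ?thesis by (simp only: sum_product)
  qed
  \<comment> \<open>The interchanges put the sum over the nodes innermost, ready for
    orthogonality.\<close>
  also have "\<dots> = (\<Sum>k\<in>?D. \<Sum>l\<in>?D. \<Sum>n\<in>?D. (?S l * ?c k * expi k x) * expi (l - k) (node j n))"
    by (subst sum.swap, subst (2) sum.swap, subst sum.swap) (rule refl)
  also have "\<dots> = (\<Sum>k\<in>?D. \<Sum>l\<in>?D. if l = k then ?S l * ?c k * expi k x * 2 ^ j else 0)"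
    by (intro sum.cong refl) (simp add: sum_expi_node D_set_diff_lt flip: sum_distrib_left)
  also have "\<dots> = (\<Sum>k\<in>?D. ?c k * ?S k * expi k x) * 2 ^ j"
    by (simp add: sum_distrib_left mult_ac)
  finally show "quasi_interp j f \<phi> T x = (\<Sum>k\<in>?D. (?c k * ?S k) * expi k x)"
    by (simp add: quasi_interp_def)
qed

lemma fourier_coeff_quasi_interp_error:
  assumes "f absolutely_integrable_on {-pi..pi}"
    and "(\<lambda>\<nu>. norm (fourier_coeff f \<nu> * dist_coeff T \<nu>)) summable_on UNIV" "\<phi> \<in> trig_poly j"
  shows "fourier_coeff (\<lambda>x. f x - quasi_interp j f \<phi> T x) k =
    fourier_coeff f k - (if k \<in> D_set j then fourier_coeff \<phi> k * aliased_coeff j f T k else 0)"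
  unfolding quasi_interp_eq[OF assms(2,3)]
  by (subst fourier_coeff_diff[OF assms(1) trig_poly_integrable])
    (simp add: fourier_coeff_trig_poly)

subsection \<open>Aliasing weights\<close>

text \<open>The modulus of \<open>k\<close> is at most half of \<open>2 ^ j\<close>, hence at most
  half of that of \<open>2 ^ j * \<mu>\<close>; the triangle inequality gives both bounds.\<close>

lemma lattice_abs_bounds:
  assumes "k \<in> D_set j" "\<mu> \<noteq> 0"
  shows "2 ^ j * \<bar>\<mu>\<bar> \<le> 2 * \<bar>k + 2 ^ j * \<mu>\<bar>" "\<bar>k + 2 ^ j * \<mu>\<bar> \<le> 2 * (2 ^ j * \<bar>\<mu>\<bar>)"
proof -
  have k: "2 * \<bar>k\<bar> \<le> 2 ^ j" by (rule abs_D_set_le[OF assms(1)])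
  have x: "2 ^ j * \<bar>\<mu>\<bar> = \<bar>2 ^ j * \<mu>\<bar>" by (simp add: abs_mult)
  have ge: "(2 ^ j :: int) * 1 \<le> 2 ^ j * \<bar>\<mu>\<bar>" using assms(2) by (intro mult_left_mono) auto
  show "2 ^ j * \<bar>\<mu>\<bar> \<le> 2 * \<bar>k + 2 ^ j * \<mu>\<bar>"
    using abs_triangle_ineq4[of "k + 2 ^ j * \<mu>" k] k x ge by simp
  show "\<bar>k + 2 ^ j * \<mu>\<bar> \<le> 2 * (2 ^ j * \<bar>\<mu>\<bar>)"
    using abs_triangle_ineq[of k "2 ^ j * \<mu>"] k x ge by simp
qed

lemma lattice_real_abs_bounds:
  assumes "k \<in> D_set j" "\<mu> \<noteq> 0"
  shows "2 ^ j * \<bar>of_int \<mu>\<bar> / 2 \<le> \<bar>of_int (k + 2 ^ j * \<mu>) :: real\<bar>"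
    "\<bar>of_int (k + 2 ^ j * \<mu>) :: real\<bar> \<le> 2 * (2 ^ j * \<bar>of_int \<mu>\<bar>)"
proof -
  have "real_of_int (2 ^ j * \<bar>\<mu>\<bar>) \<le> of_int (2 * \<bar>k + 2 ^ j * \<mu>\<bar>)"
    "real_of_int \<bar>k + 2 ^ j * \<mu>\<bar> \<le> of_int (2 * (2 ^ j * \<bar>\<mu>\<bar>))"
    using lattice_abs_bounds[OF assms] by (simp_all only: of_int_le_iff)
  then show "2 ^ j * \<bar>of_int \<mu>\<bar> / 2 \<le> \<bar>of_int (k + 2 ^ j * \<mu>) :: real\<bar>"
    "\<bar>of_int (k + 2 ^ j * \<mu>) :: real\<bar> \<le> 2 * (2 ^ j * \<bar>of_int \<mu>\<bar>)"
    by simp_all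
qed

section \<open>Weights and power sums over the integers\<close>

definition weight :: "real \<Rightarrow> int \<Rightarrow> real" where
  "weight \<alpha> k = (1 + \<bar>of_int k\<bar>) powr \<alpha>"

lemma weight_pos [simp]: "0 < weight \<alpha> k"
  by (simp add: weight_def)

lemma weight_zero [simp]: "weight 0 k = 1"
  using weight_pos[of 0 k] by (simp add: weight_def split: if_splits)

lemma weight_add: "weight (\<alpha> + \<beta>) k = weight \<alpha> k * weight \<beta> k"
  by (simp add: weight_def powr_add)

lemma weight_mono: "\<alpha> \<le> \<beta> \<Longrightarrow> weight \<alpha> k \<le> weight \<beta> k"
  by (simp add: weight_def powr_mono)

lemma weight_minus_le:
  assumes "0 \<le> \<alpha>" "0 < x" "x \<le> \<bar>of_int k\<bar>"
  shows "weight (- \<alpha>) k \<le> x powr (- \<alpha>)"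
  unfolding weight_def using assms by (intro powr_mono2') auto

text \<open>On the nonnegative and on the negative integers the modulus is injective, so each half
  is bounded by a convergent \<open>p\<close>-series. The index 0 adds nothing, because
  \<open>0 powr (- a) = 0\<close>.\<close>

lemma summable_powr_int:
  fixes a :: real
  assumes "1 < a"
  obtains B where "0 \<le> B" "\<And>F. finite F \<Longrightarrow> (\<Sum>\<mu>\<in>F. \<bar>of_int \<mu>\<bar> powr (- a)) \<le> B"
proof (rule that)
  let ?h = "\<lambda>n::nat. real n powr (- a)"
  have s: "summable ?h" using assms by (simp add: summable_real_powr_iff)
  show "0 \<le> 2 * suminf ?h" using suminf_nonneg[OF s] by simp
  fix F :: "int set" assume F: "finite F"
  have half: "(\<Sum>\<mu>\<in>G. \<bar>of_int \<mu>\<bar> powr (- a)) \<le> suminf ?h"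
    if "finite G" "inj_on (\<lambda>\<mu>. nat \<bar>\<mu>\<bar>) G" for G :: "int set"
  proof -
    have "(\<Sum>\<mu>\<in>G. \<bar>of_int \<mu>\<bar> powr (- a)) = (\<Sum>n\<in>(\<lambda>\<mu>. nat \<bar>\<mu>\<bar>) ` G. ?h n)"
      by (simp add: sum.reindex[OF that(2)])
    also have "\<dots> \<le> suminf ?h"
      using that by (intro sum_le_suminf[OF s]) auto
    finally show ?thesis .
  qed
  have "(\<Sum>\<mu>\<in>F. \<bar>of_int \<mu>\<bar> powr (- a)) =
      (\<Sum>\<mu>\<in>F \<inter> {0..}. \<bar>of_int \<mu>\<bar> powr (- a)) + (\<Sum>\<mu>\<in>F - {0..}. \<bar>of_int \<mu>\<bar> powr (- a))"
    by (rule sum.Int_Diff[OF F])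
  also have "\<dots> \<le> suminf ?h + suminf ?h"
    using F by (intro add_mono half) (auto simp: inj_on_def)
  finally show "(\<Sum>\<mu>\<in>F. \<bar>of_int \<mu>\<bar> powr (- a)) \<le> 2 * suminf ?h" by simp
qed

text \<open>For finite \<open>q'\<close> the condition says that \<open>a\<close> times
  \<open>q'\<close> exceeds 1; for \<open>q = 1\<close> only boundedness is at stake, so
  \<open>a = 0\<close> is allowed. Condition (i) enters here, with
  \<open>a = \<alpha> - N\<close>.\<close>

lemma lp_norm_powr_int:
  fixes q q' :: ennreal and a :: real
  assumes "1 \<le> q" "1 / q + 1 / q' = 1"
    and a: "q \<noteq> 1 \<longrightarrow> a > enn2real (1 / q')" "q = 1 \<longrightarrow> a \<ge> 0"
  obtains B where "0 \<le> B"
    "lp_norm q' (\<lambda>\<mu>. if \<mu> = 0 then 0 else of_real (\<bar>of_int \<mu>\<bar> powr (- a))) \<le> ennreal B"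
proof -
  let ?b = "\<lambda>\<mu>::int. if \<mu> = 0 then 0 else complex_of_real (\<bar>of_int \<mu>\<bar> powr (- a))"
  have real: "\<exists>B\<ge>0. lp_norm (ennreal p) ?b \<le> ennreal B" if p: "1 \<le> p" "1 < a * p" for p
  proof -
    obtain B where B: "0 \<le> B" "\<And>F. finite F \<Longrightarrow> (\<Sum>\<mu>\<in>F. \<bar>of_int \<mu>\<bar> powr (- (a * p))) \<le> B"
      using summable_powr_int[OF p(2)] by blast
    \<comment> \<open>At \<open>\<mu> = 0\<close> both sides are 0 by the convention for
      \<open>0 powr\<close>.\<close>
    have "norm (?b \<mu>) powr p = \<bar>of_int \<mu>\<bar> powr (- (a * p))" for \<mu>
      using p by (simp add: powr_powr)
    then have "lp_norm (ennreal p) ?b \<le> ennreal (B powr (1 / p))"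
      using B p by (subst lp_norm_real_le_iff) (auto simp: powr_powr)
    then show ?thesis by (intro exI[of _ "B powr (1 / p)"]) simp
  qed
  have "\<exists>B\<ge>0. lp_norm q' ?b \<le> ennreal B"
    using assms(1,2)
  proof (cases rule: conjugate_exponent_cases)
    case 1
    then have "a > 1" using a by (simp add: divide_ennreal_def)
    then show ?thesis using real[of 1] 1 by simp
  next
    case 2
    then have "0 \<le> a" using a by simp
    have "norm (?b \<mu>) \<le> 1" for \<mu>
    proof (cases "\<mu> = 0")
      case False
      then have "1 \<le> \<bar>of_int \<mu> :: real\<bar>" by linarith
      then have "\<bar>of_int \<mu> :: real\<bar> powr (- a) \<le> \<bar>of_int \<mu>\<bar> powr 0"
        using \<open>0 \<le> a\<close> by (intro powr_mono) auto
      then show ?thesis using False by simp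
    qed simp
    then show ?thesis unfolding 2 by (intro exI[of _ 1]) (subst lp_norm_top_le_iff; simp)
  next
    case (3 p p')
    then have "enn2real (1 / q') = 1 / p'"
      by (simp add: divide_ennreal flip: ennreal_1)
    moreover have "q \<noteq> 1" using 3 by (simp flip: ennreal_1)
    ultimately have "1 / p' < a" using a by simp
    then have "1 < a * p'" using 3 by (simp add: divide_less_eq)
    then show ?thesis using real[of p'] 3 by simp
  qed
  then show ?thesis using that by blast
qed

text \<open>The second factor in Hoelder's inequality: its negative weight cancels the weight put on
  the coefficients of \<open>f\<close>. The entry at \<open>\<mu> = 0\<close> is removed because
  that frequency belongs to the multiplier term.\<close>

definition alias_kernel :: "real \<Rightarrow> nat \<Rightarrow> ((real \<Rightarrow> complex) \<Rightarrow> complex) \<Rightarrow> int \<Rightarrow> int \<Rightarrow> complex" where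
  "alias_kernel \<alpha> j T k \<mu> =
    (if \<mu> = 0 then 0 else of_real (weight (- \<alpha>) (k + 2 ^ j * \<mu>)) * dist_coeff T (k + 2 ^ j * \<mu>))"

text \<open>For nonzero \<mu> the frequency is comparable to
  \<open>2 ^ j * \<bar>\<mu>\<bar>\<close>. The weight then gives
  \<open>(2 ^ j * \<bar>\<mu>\<bar>) powr (- \<alpha>)\<close> and the dual coefficient grows at
  most like \<open>\<bar>\<mu>\<bar> powr N\<close>, up to constants, which leaves a summable or
  bounded power of \<mu>.\<close>

lemma alias_kernel_bound_decay:
  fixes q q' :: ennreal
  assumes "1 \<le> q" "1 / q + 1 / q' = 1" "0 \<le> N" "0 < \<alpha>"
    and "q \<noteq> 1 \<longrightarrow> \<alpha> > N + enn2real (1 / q')" "q = 1 \<longrightarrow> \<alpha> \<ge> N"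
    and T: "\<And>j l. norm (dist_coeff (T j) l) \<le> Ct * (1 + rpow \<bar>of_int l / 2 ^ j\<bar> N)"
  shows "\<exists>K\<ge>0. \<forall>j. \<forall>k\<in>D_set j. lp_norm q' (alias_kernel \<alpha> j (T j) k) \<le> ennreal (K * (2 ^ j) powr (- \<alpha>))"
proof -
  obtain B where B: "0 \<le> B"
    "lp_norm q' (\<lambda>\<mu>. if \<mu> = 0 then 0 else of_real (\<bar>of_int \<mu>\<bar> powr (- (\<alpha> - N)))) \<le> ennreal B"
  proof (rule lp_norm_powr_int[OF assms(1,2), of "\<alpha> - N"])
    show "q \<noteq> 1 \<longrightarrow> \<alpha> - N > enn2real (1 / q')" "q = 1 \<longrightarrow> \<alpha> - N \<ge> 0" using assms(5,6) by auto
  qed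
  \<comment> \<open>\<open>2 powr \<alpha>\<close> comes from the lower frequency bound, which loses
    a half; \<open>2 * 2 powr N\<close> comes from the upper one, which loses a factor 2, and from
    absorbing the summand 1. The sign of \<open>Ct\<close> is not assumed.\<close>
  let ?K = "2 powr \<alpha> * (\<bar>Ct\<bar> * (2 * 2 powr N))"
  have "lp_norm q' (alias_kernel \<alpha> j (T j) k) \<le> ennreal (?K * (2 ^ j) powr (- \<alpha>) * B)"
    if k: "k \<in> D_set j" for j k
  proof (rule lp_norm_mono_scale[OF conjugate_exponent_ge_1[OF assms(1,2)] _ B])
    fix \<mu> :: int
    show "norm (alias_kernel \<alpha> j (T j) k \<mu>) \<le> ?K * (2 ^ j) powr (- \<alpha>) *
        norm (if \<mu> = 0 then 0 else complex_of_real (\<bar>of_int \<mu>\<bar> powr (- (\<alpha> - N))))"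
    proof (cases "\<mu> = 0")
      case False
      let ?m = "\<bar>of_int \<mu> :: real\<bar>" and ?M = "2 ^ j :: real" and ?l = "k + 2 ^ j * \<mu>"
      have m: "1 \<le> ?m" using False by linarith
      have "weight (- \<alpha>) ?l \<le> (?M * ?m / 2) powr (- \<alpha>)"
        using lattice_real_abs_bounds(1)[OF k False] assms m by (intro weight_minus_le) auto
      also have "\<dots> = 2 powr \<alpha> * ?M powr (- \<alpha>) * ?m powr (- \<alpha>)"
        using m by (simp add: powr_divide powr_mult powr_minus divide_simps)
      finally have w: "weight (- \<alpha>) ?l \<le> 2 powr \<alpha> * ?M powr (- \<alpha>) * ?m powr (- \<alpha>)" .
      have "\<bar>of_int ?l / ?M\<bar> \<le> 2 * ?m"
        using lattice_real_abs_bounds(2)[OF k False] by (simp add: abs_divide divide_le_eq mult_ac)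
      \<comment> \<open>For \<open>N = 0\<close> both sides are 1, since \<open>2 * ?m\<close> is
        positive.\<close>
      then have "rpow \<bar>of_int ?l / ?M\<bar> N \<le> (2 * ?m) powr N"
        using assms m by (auto simp: rpow_def intro: powr_mono2)
      moreover have "1 \<le> (2 * ?m) powr N"
        using assms m by (intro ge_one_powr_ge_zero) auto
      ultimately have "1 + rpow \<bar>of_int ?l / ?M\<bar> N \<le> 2 * (2 * ?m) powr N" by linarith
      then have "\<bar>Ct\<bar> * (1 + rpow \<bar>of_int ?l / ?M\<bar> N) \<le> \<bar>Ct\<bar> * (2 * (2 * ?m) powr N)"
        by (rule mult_left_mono) simp
      moreover have "Ct * (1 + rpow \<bar>of_int ?l / ?M\<bar> N) \<le> \<bar>Ct\<bar> * (1 + rpow \<bar>of_int ?l / ?M\<bar> N)"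
        by (intro mult_right_mono) (auto simp: rpow_def)
      ultimately have "norm (dist_coeff (T j) ?l) \<le> \<bar>Ct\<bar> * (2 * (2 * ?m) powr N)"
        using T[of j ?l] by linarith
      then have "norm (dist_coeff (T j) ?l) \<le> \<bar>Ct\<bar> * (2 * 2 powr N) * ?m powr N"
        by (simp add: powr_mult mult_ac)
      with w have "weight (- \<alpha>) ?l * norm (dist_coeff (T j) ?l) \<le>
          (2 powr \<alpha> * ?M powr (- \<alpha>) * ?m powr (- \<alpha>)) * (\<bar>Ct\<bar> * (2 * 2 powr N) * ?m powr N)"
        by (intro mult_mono) auto
      also have "\<dots> = ?K * ?M powr (- \<alpha>) * (?m powr (- \<alpha>) * ?m powr N)"
        by (simp add: mult_ac)
      also have "?m powr (- \<alpha>) * ?m powr N = ?m powr (- (\<alpha> - N))"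
        by (simp flip: powr_add)
      finally show ?thesis using False by (simp add: alias_kernel_def norm_mult less_imp_le)
    qed (simp add: alias_kernel_def)
  qed simp
  then show ?thesis
    using B by (intro exI[of _ "?K * B"]) (auto simp: mult_ac)
qed

lemma lp_norm_dist_coeff_le_amalgam_norm:
  assumes "k \<in> D_set j"
  shows "lp_norm r (\<lambda>\<mu>. dist_coeff T (k + 2 ^ j * \<mu>)) \<le> amalgam_norm r j T"
proof (cases "r = top")
  case True
  then show ?thesis by (auto simp: amalgam_norm_def lp_norm_def intro!: SUP_least intro: SUP_upper)
next
  case False
  then show ?thesis using assms by (auto simp: amalgam_norm_def intro: SUP_upper)
qed

text \<open>Here the weight only supplies the factor \<open>(2 ^ j) powr (- \<alpha>)\<close>, as
  every frequency with nonzero \<mu> is at least half of \<open>2 ^ j\<close> in modulus; summation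
  over \<mu> is paid for by the amalgam norm.\<close>

lemma alias_kernel_bound_amalgam:
  fixes q q' :: ennreal
  assumes "1 \<le> q" "1 / q + 1 / q' = 1" "0 < \<alpha>"
    and "(SUP j. amalgam_norm q' j (T j)) < top"
  shows "\<exists>K\<ge>0. \<forall>j. \<forall>k\<in>D_set j. lp_norm q' (alias_kernel \<alpha> j (T j) k) \<le> ennreal (K * (2 ^ j) powr (- \<alpha>))"
proof -
  obtain B where B: "0 \<le> B" "(SUP j. amalgam_norm q' j (T j)) = ennreal B"
    using assms(4) by (cases "SUP j. amalgam_norm q' j (T j)") auto
  have "lp_norm q' (alias_kernel \<alpha> j (T j) k) \<le> ennreal (2 powr \<alpha> * (2 ^ j) powr (- \<alpha>) * B)"
    if k: "k \<in> D_set j" for j k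
  proof (rule lp_norm_mono_scale[OF conjugate_exponent_ge_1[OF assms(1,2)] _ B(1)])
    have "amalgam_norm q' j (T j) \<le> ennreal B"
      unfolding B(2)[symmetric] by (rule SUP_upper) simp
    then show "lp_norm q' (\<lambda>\<mu>. dist_coeff (T j) (k + 2 ^ j * \<mu>)) \<le> ennreal B"
      using lp_norm_dist_coeff_le_amalgam_norm[OF k] order_trans by blast
    fix \<mu> :: int
    let ?l = "k + 2 ^ j * \<mu>" and ?M = "2 ^ j :: real"
    show "norm (alias_kernel \<alpha> j (T j) k \<mu>) \<le> 2 powr \<alpha> * ?M powr (- \<alpha>) * norm (dist_coeff (T j) ?l)"
    proof (cases "\<mu> = 0")
      case False
      have "?M * 1 \<le> ?M * \<bar>of_int \<mu>\<bar>" using False by (intro mult_left_mono) (linarith, simp)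
      then have "?M / 2 \<le> \<bar>of_int ?l\<bar>"
        using lattice_real_abs_bounds(1)[OF k False] by linarith
      then have "weight (- \<alpha>) ?l \<le> (?M / 2) powr (- \<alpha>)"
        using assms by (intro weight_minus_le) auto
      also have "\<dots> = 2 powr \<alpha> * ?M powr (- \<alpha>)"
        by (simp add: powr_divide powr_minus divide_simps)
      finally show ?thesis
        using False by (simp add: alias_kernel_def norm_mult less_imp_le mult_right_mono)
    qed (simp add: alias_kernel_def)
  qed simp
  then show ?thesis
    using B by (intro exI[of _ "2 powr \<alpha> * B"]) (auto simp: mult_ac)
qed

subsection \<open>The error estimate\<close>

lemma has_sum_if_eq:
  fixes c :: "'a::{comm_monoid_add, topological_space}"
  shows "((\<lambda>\<mu>. if \<mu> = a then c else 0) has_sum c) UNIV"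
proof -
  have "((\<lambda>\<mu>. if \<mu> = a then c else 0) has_sum c) {a}"
    using has_sum_finite[of "{a}" "\<lambda>\<mu>. if \<mu> = a then c else 0"] by simp
  then show ?thesis
    by (rule has_sum_cong_neutral[THEN iffD1, rotated -1]) auto
qed

text \<open>The term at \<open>\<mu> = 0\<close> is split off; in the others the weights cancel in
  \<open>?u \<mu> * ?v \<mu>\<close>, and Hoelder's inequality applies.\<close>

lemma aliased_coeff_bound:
  assumes "1 \<le> q" "1 / q + 1 / q' = 1" "0 \<le> A" "0 \<le> B"
    and u: "lp_norm q (\<lambda>\<mu>. of_real (weight \<alpha> (k + 2 ^ j * \<mu>)) * fourier_coeff f (k + 2 ^ j * \<mu>)) \<le> ennreal A"
    and v: "lp_norm q' (alias_kernel \<alpha> j T k) \<le> ennreal B"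
  shows "(\<lambda>\<mu>. norm (fourier_coeff f (k + 2 ^ j * \<mu>) * dist_coeff T (k + 2 ^ j * \<mu>))) summable_on UNIV"
    "norm (aliased_coeff j f T k - fourier_coeff f k * dist_coeff T k) \<le> A * B"
proof -
  let ?u = "\<lambda>\<mu>. of_real (weight \<alpha> (k + 2 ^ j * \<mu>)) * fourier_coeff f (k + 2 ^ j * \<mu>)"
  let ?v = "alias_kernel \<alpha> j T k"
  let ?g = "\<lambda>\<mu>. fourier_coeff f (k + 2 ^ j * \<mu>) * dist_coeff T (k + 2 ^ j * \<mu>)"
  let ?d = "\<lambda>\<mu>. if \<mu> = 0 then ?g 0 else 0"
  have uv: "?u \<mu> * ?v \<mu> = (if \<mu> = 0 then 0 else ?g \<mu>)" for \<mu>
  proof -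
    have "complex_of_real (weight \<alpha> l) * of_real (weight (- \<alpha>) l) = 1" for l
      by (simp flip: of_real_mult weight_add)
    then show ?thesis by (simp add: alias_kernel_def mult_ac)
  qed
  have g: "?g \<mu> = ?d \<mu> + ?u \<mu> * ?v \<mu>" for \<mu>
    unfolding uv by simp
  \<comment> \<open>The two parts have disjoint supports in \<mu>, so their norms add
    exactly.\<close>
  have norm_g: "norm (?g \<mu>) = norm (?d \<mu>) + norm (?u \<mu> * ?v \<mu>)" for \<mu>
    unfolding uv by simp
  have norm_d: "norm (?d \<mu>) = (if \<mu> = 0 then norm (?g 0) else 0)" for \<mu>
    by simp
  have nd: "(\<lambda>\<mu>. norm (?d \<mu>)) summable_on UNIV"
    unfolding norm_d by (rule has_sum_imp_summable[OF has_sum_if_eq])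
  have s: "(\<lambda>\<mu>. norm (?u \<mu> * ?v \<mu>)) summable_on UNIV"
    and le: "norm (\<Sum>\<^sub>\<infinity>\<mu>. ?u \<mu> * ?v \<mu>) \<le> A * B"
    using lp_norm_Hoelder_infsum[OF assms] by blast+
  show "(\<lambda>\<mu>. norm (?g \<mu>)) summable_on UNIV"
    unfolding norm_g by (rule summable_on_add[OF nd s])
  have "aliased_coeff j f T k = infsum (\<lambda>\<mu>. ?d \<mu> + ?u \<mu> * ?v \<mu>) UNIV"
    unfolding aliased_coeff_def by (rule infsum_cong) (rule g)
  also have "\<dots> = ?g 0 + (\<Sum>\<^sub>\<infinity>\<mu>. ?u \<mu> * ?v \<mu>)"
    by (rule infsumI[OF has_sum_add[OF has_sum_if_eq has_sum_infsum[OF abs_summable_summable[OF s]]]])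
  finally have "aliased_coeff j f T k - ?g 0 = (\<Sum>\<^sub>\<infinity>\<mu>. ?u \<mu> * ?v \<mu>)"
    by (simp only: add_diff_cancel_left')
  with le show "norm (aliased_coeff j f T k - fourier_coeff f k * dist_coeff T k) \<le> A * B"
    by (simp only: mult_zero_right add_0_right)
qed

text \<open>Outside \<open>D_set j\<close> the modulus of \<open>k\<close> is at least half of
  \<open>2 ^ j\<close>, so the surplus smoothness \<open>\<alpha> - \<gamma>\<close> turns into
  decay in \<open>j\<close>.\<close>

lemma weight_high_frequency:
  assumes "k \<notin> D_set j" "\<gamma> \<le> \<alpha>"
  shows "weight \<gamma> k \<le> 2 powr (\<alpha> - \<gamma>) * (2 ^ j) powr (- (\<alpha> - \<gamma>)) * weight \<alpha> k"
proof -
  have "real_of_int (2 ^ j) \<le> of_int (2 * \<bar>k\<bar>)"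
    using abs_not_D_set_ge[OF assms(1)] by (simp only: of_int_le_iff)
  then have "weight (- (\<alpha> - \<gamma>)) k \<le> (2 ^ j / 2) powr (- (\<alpha> - \<gamma>))"
    using assms(2) by (intro weight_minus_le) auto
  also have "\<dots> = 2 powr (\<alpha> - \<gamma>) * (2 ^ j) powr (- (\<alpha> - \<gamma>))"
    by (simp add: powr_divide powr_minus divide_simps powr_diff)
  finally have "weight (- (\<alpha> - \<gamma>)) k * weight \<alpha> k \<le> 2 powr (\<alpha> - \<gamma>) * (2 ^ j) powr (- (\<alpha> - \<gamma>)) * weight \<alpha> k"
    by (rule mult_right_mono) (simp add: less_imp_le)
  then show ?thesis by (simp flip: weight_add)
qed

text \<open>The ratio \<open>\<bar>k\<bar> / 2 ^ j\<close> is at most 1 on \<open>D_set j\<close>,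
  so \<open>s\<close> may be lowered to \<open>?m\<close>. The resulting weight is absorbed because
  \<open>\<gamma> + ?m \<le> \<alpha>\<close>; this is how the minimum enters the rate.\<close>

lemma weight_low_frequency:
  assumes "k \<in> D_set j" "0 < s" "\<gamma> < \<alpha>"
  shows "weight \<gamma> k * rpow \<bar>of_int k / 2 ^ j\<bar> s \<le> (2 ^ j) powr (- min (\<alpha> - \<gamma>) s) * weight \<alpha> k"
proof -
  let ?m = "min (\<alpha> - \<gamma>) s" and ?M = "2 ^ j :: real"
  have m: "0 \<le> ?m" using assms by simp
  have "real_of_int (2 * \<bar>k\<bar>) \<le> of_int (2 ^ j)"
    using abs_D_set_le[OF assms(1)] by (simp only: of_int_le_iff)
  then have k: "\<bar>of_int k\<bar> \<le> ?M" by simp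
  have "rpow \<bar>of_int k / ?M\<bar> s = (\<bar>of_int k\<bar> / ?M) powr s"
    using assms(2) by (simp add: rpow_def abs_divide)
  also have "\<dots> \<le> (\<bar>of_int k\<bar> / ?M) powr ?m"
    using k by (intro powr_mono') auto
  also have "\<dots> \<le> ((1 + \<bar>of_int k\<bar>) / ?M) powr ?m"
    using m by (intro powr_mono2 divide_right_mono) auto
  also have "\<dots> = ?M powr (- ?m) * weight ?m k"
    by (simp add: weight_def powr_divide powr_minus_divide)
  finally have "weight \<gamma> k * rpow \<bar>of_int k / ?M\<bar> s \<le> weight \<gamma> k * (?M powr (- ?m) * weight ?m k)"
    by (rule mult_left_mono) (simp add: less_imp_le)
  also have "\<dots> = ?M powr (- ?m) * weight (\<gamma> + ?m) k"
    by (simp add: weight_add mult_ac)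
  also have "\<dots> \<le> ?M powr (- ?m) * weight \<alpha> k"
    by (intro mult_left_mono weight_mono) auto
  finally show ?thesis .
qed

lemma weight_D_set_le:
  assumes "k \<in> D_set j" "0 \<le> \<gamma>"
  shows "weight \<gamma> k \<le> 2 powr \<gamma> * (2 ^ j) powr \<gamma>"
proof -
  have "real_of_int (2 * \<bar>k\<bar>) \<le> of_int (2 ^ j)"
    using abs_D_set_le[OF assms(1)] by (simp only: of_int_le_iff)
  then have "2 * \<bar>of_int k\<bar> \<le> (2 ^ j :: real)" by simp
  moreover have "1 \<le> (2 ^ j :: real)" by simp
  ultimately have "1 + \<bar>of_int k\<bar> \<le> 2 * (2 ^ j :: real)" by linarith
  then have "weight \<gamma> k \<le> (2 * 2 ^ j) powr \<gamma>"
    unfolding weight_def using assms(2) by (intro powr_mono2) auto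
  then show ?thesis by (simp add: powr_mult)
qed

lemma wiener_norm_eq: "wiener_norm q \<alpha> f = lp_norm q (\<lambda>k. of_real (weight \<alpha> k) * fourier_coeff f k)"
  by (simp add: wiener_norm_def weight_def)

text \<open>The three summands of \<open>c\<close> belong to the high frequencies, the multiplier
  term and the aliasing term. Each weighted error coefficient is dominated by that of
  \<open>f\<close> plus the norm of its residue class, and both sequences have norm at most
  \<open>A\<close>.\<close>

lemma quasi_interp_error_bound:
  fixes q q' :: ennreal
  assumes q: "1 \<le> q" "1 / q + 1 / q' = 1" and "0 \<le> \<gamma>" "\<gamma> < \<alpha>" "0 < s" "0 \<le> K"
    and \<phi>: "\<phi> \<in> trig_poly j" "\<And>l. norm (fourier_coeff \<phi> l) \<le> C\<^sub>\<phi>"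
    and \<phi>T: "\<And>l. l \<in> D_set j \<Longrightarrow>
      norm (1 - fourier_coeff \<phi> l * dist_coeff T l) \<le> C\<^sub>s * rpow \<bar>of_int l / 2 ^ j\<bar> s"
    and v: "\<And>k. k \<in> D_set j \<Longrightarrow> lp_norm q' (alias_kernel \<alpha> j T k) \<le> ennreal (K * (2 ^ j) powr (- \<alpha>))"
    and f: "f \<in> L1_torus" and A: "0 \<le> A" "wiener_norm q \<alpha> f \<le> ennreal A"
  defines "c \<equiv> 2 powr (\<alpha> - \<gamma>) + \<bar>C\<^sub>s\<bar> + 2 powr \<gamma> * \<bar>C\<^sub>\<phi>\<bar> * K"
  shows "wiener_norm q \<gamma> (\<lambda>x. f x - quasi_interp j f \<phi> T x) \<le>
    ennreal (4 * (c * (2 ^ j) powr (- min (\<alpha> - \<gamma>) s)) * A)"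
proof -
  let ?M = "2 ^ j :: real" and ?m = "min (\<alpha> - \<gamma>) s"
  let ?u = "\<lambda>k. complex_of_real (weight \<alpha> k) * fourier_coeff f k"
  have "1 \<le> ?M" by simp
  have c: "0 \<le> 2 powr (\<alpha> - \<gamma>)" "0 \<le> \<bar>C\<^sub>s\<bar>" "0 \<le> 2 powr \<gamma> * \<bar>C\<^sub>\<phi>\<bar> * K"
    using \<open>0 \<le> K\<close> by auto
  then have "0 \<le> c" by (simp add: c_def)
  have u: "lp_norm q ?u \<le> ennreal A" using A(2) by (simp add: wiener_norm_eq)
  obtain S where S: "\<And>k. 0 \<le> S k" "\<And>k. lp_norm q (\<lambda>\<mu>. ?u (k + 2 ^ j * \<mu>)) \<le> ennreal (S k)"
    "lp_norm q (\<lambda>k. if k \<in> D_set j then complex_of_real (S k) else 0) \<le> ennreal A"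
    using lp_norm_blocks[OF q(1) A(1) u, of j] by blast
  let ?B = "K * ?M powr (- \<alpha>)"
  have B: "0 \<le> ?B" using \<open>0 \<le> K\<close> by simp
  note aliased = aliased_coeff_bound[OF q S(1) B S(2) v]
  have f_int: "f absolutely_integrable_on {-pi..pi}" using f by (simp add: L1_torus_def)
  have summable: "(\<lambda>\<nu>. norm (fourier_coeff f \<nu> * dist_coeff T \<nu>)) summable_on UNIV"
    by (rule norm_summable_D_set_blocks) (rule aliased(1))
  have "norm (of_real (weight \<gamma> k) * fourier_coeff (\<lambda>x. f x - quasi_interp j f \<phi> T x) k) \<le>
      (c * ?M powr (- ?m)) * (norm (?u k) + norm (if k \<in> D_set j then complex_of_real (S k) else 0))"
    (is "?lhs \<le> _") for k
  proof (cases "k \<in> D_set j")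
    case False
    then have "?lhs = weight \<gamma> k * norm (fourier_coeff f k)"
      by (simp add: fourier_coeff_quasi_interp_error[OF f_int summable \<phi>(1)] norm_mult less_imp_le)
    also have "\<dots> \<le> (2 powr (\<alpha> - \<gamma>) * ?M powr (- (\<alpha> - \<gamma>)) * weight \<alpha> k) * norm (fourier_coeff f k)"
      using weight_high_frequency[OF False] \<open>\<gamma> < \<alpha>\<close> by (intro mult_right_mono) auto
    also have "\<dots> = (2 powr (\<alpha> - \<gamma>) * ?M powr (- (\<alpha> - \<gamma>))) * norm (?u k)"
      by (simp add: norm_mult less_imp_le mult.assoc)
    also have "\<dots> \<le> (c * ?M powr (- ?m)) * norm (?u k)"
      using c \<open>1 \<le> ?M\<close> by (intro mult_right_mono mult_mono powr_mono) (auto simp: c_def)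
    finally show ?thesis using False by simp
  next
    case True
    let ?a = "fourier_coeff f k" and ?p = "fourier_coeff \<phi> k" and ?t = "dist_coeff T k"
    let ?r = "aliased_coeff j f T k - ?a * ?t"
    \<comment> \<open>Substitute \<open>?a * ?t + ?r\<close> for the aliased coefficient: the first
      term measures compatibility of \<phi> with its dual, the second is pure aliasing.\<close>
    have "fourier_coeff (\<lambda>x. f x - quasi_interp j f \<phi> T x) k = ?a * (1 - ?p * ?t) - ?p * ?r"
      using True by (simp add: fourier_coeff_quasi_interp_error[OF f_int summable \<phi>(1)] algebra_simps)
    then have "?lhs = weight \<gamma> k * norm (?a * (1 - ?p * ?t) - ?p * ?r)"
      by (simp add: norm_mult less_imp_le)
    also have "\<dots> \<le> weight \<gamma> k * (norm ?a * norm (1 - ?p * ?t) + norm ?p * norm ?r)"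
      by (intro mult_left_mono order_trans[OF norm_triangle_ineq4]) (simp_all add: norm_mult less_imp_le)
    also have "\<dots> = weight \<gamma> k * norm (1 - ?p * ?t) * norm ?a + weight \<gamma> k * (norm ?p * norm ?r)"
      by (simp add: distrib_left mult_ac)
    also have "\<dots> \<le> (c * ?M powr (- ?m)) * norm (?u k) + (c * ?M powr (- ?m)) * S k"
    proof (rule add_mono)
      have "norm (1 - ?p * ?t) \<le> \<bar>C\<^sub>s\<bar> * rpow \<bar>of_int k / ?M\<bar> s"
        by (rule order_trans[OF \<phi>T[OF True]]) (intro mult_right_mono; simp add: rpow_def)
      then have "weight \<gamma> k * norm (1 - ?p * ?t) \<le> weight \<gamma> k * (\<bar>C\<^sub>s\<bar> * rpow \<bar>of_int k / ?M\<bar> s)"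
        by (rule mult_left_mono) (simp add: less_imp_le)
      also have "\<dots> = \<bar>C\<^sub>s\<bar> * (weight \<gamma> k * rpow \<bar>of_int k / ?M\<bar> s)" by simp
      also have "\<dots> \<le> \<bar>C\<^sub>s\<bar> * (?M powr (- ?m) * weight \<alpha> k)"
        using weight_low_frequency[OF True \<open>0 < s\<close> \<open>\<gamma> < \<alpha>\<close>] by (rule mult_left_mono) simp
      also have "\<dots> \<le> c * (?M powr (- ?m) * weight \<alpha> k)"
        using c by (intro mult_right_mono) (auto simp: c_def less_imp_le)
      finally have "weight \<gamma> k * norm (1 - ?p * ?t) * norm ?a \<le> c * (?M powr (- ?m) * weight \<alpha> k) * norm ?a"
        by (rule mult_right_mono) simp
      then show "weight \<gamma> k * norm (1 - ?p * ?t) * norm ?a \<le> (c * ?M powr (- ?m)) * norm (?u k)"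
        by (simp add: norm_mult less_imp_le mult.assoc)
      have "norm ?p * norm ?r \<le> \<bar>C\<^sub>\<phi>\<bar> * (S k * ?B)"
        using \<phi>(2)[of k] aliased(2)[OF True] by (intro mult_mono) auto
      then have "weight \<gamma> k * (norm ?p * norm ?r) \<le> (2 powr \<gamma> * ?M powr \<gamma>) * (\<bar>C\<^sub>\<phi>\<bar> * (S k * ?B))"
        by (rule mult_mono[OF weight_D_set_le[OF True \<open>0 \<le> \<gamma>\<close>]]) auto
      also have "\<dots> = (2 powr \<gamma> * \<bar>C\<^sub>\<phi>\<bar> * K) * (?M powr \<gamma> * ?M powr (- \<alpha>)) * S k"
        by (simp only: mult_ac)
      \<comment> \<open>The weight on \<open>D_set j\<close> grows at most like
        \<open>?M powr \<gamma>\<close>, against the decay \<open>?M powr (- \<alpha>)\<close> of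
        the kernel.\<close>
      also have "?M powr \<gamma> * ?M powr (- \<alpha>) = ?M powr (- (\<alpha> - \<gamma>))"
        by (simp flip: powr_add)
      also have "(2 powr \<gamma> * \<bar>C\<^sub>\<phi>\<bar> * K) * ?M powr (- (\<alpha> - \<gamma>)) * S k \<le> (c * ?M powr (- ?m)) * S k"
        using c S(1) \<open>1 \<le> ?M\<close> \<open>0 \<le> c\<close> by (intro mult_right_mono mult_mono powr_mono) (auto simp: c_def)
      finally show "weight \<gamma> k * (norm ?p * norm ?r) \<le> (c * ?M powr (- ?m)) * S k" .
    qed
    finally show ?thesis using True S(1)[of k] by (simp add: distrib_left)
  qed
  then show ?thesis
    unfolding wiener_norm_eq using \<open>0 \<le> c\<close>
    by (intro lp_norm_add_le[OF q(1) _ A(1) u S(3)]) auto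
qed

theorem lemma3p1:
  fixes q q' :: ennreal
    and \<alpha> \<gamma> N s :: real
    and \<phi> :: "nat \<Rightarrow> real \<Rightarrow> complex"
    and \<phi>t :: "nat \<Rightarrow> (real \<Rightarrow> complex) \<Rightarrow> complex"
    and C\<^sub>\<phi>\<^sub>t C\<^sub>\<phi> C\<^sub>s :: real
  assumes "1 \<le> q" and "1 / q + 1 / q' = 1"
    and "0 \<le> \<gamma>" and "\<gamma> < \<alpha>"
    and "\<And>j. \<phi>t j \<in> periodic_distribution"
    and "\<And>j. \<phi> j \<in> trig_poly j"
    and "0 \<le> N" and "0 < s"
    and "\<And>j l. norm (dist_coeff (\<phi>t j) l) \<le> C\<^sub>\<phi>\<^sub>t * (1 + rpow \<bar>of_int l / 2 ^ j\<bar> N)"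
    and "\<And>j l. norm (fourier_coeff (\<phi> j) l) \<le> C\<^sub>\<phi>"
    and "\<And>j l. l \<in> D_set j \<Longrightarrow>
           norm (1 - fourier_coeff (\<phi> j) l * dist_coeff (\<phi>t j) l) \<le> C\<^sub>s * rpow \<bar>of_int l / 2 ^ j\<bar> s"
    and "((q \<noteq> 1 \<longrightarrow> \<alpha> > N + enn2real (1 / q')) \<and> (q = 1 \<longrightarrow> \<alpha> \<ge> N))
         \<or> (N = 0 \<and> (SUP j. amalgam_norm q' j (\<phi>t j)) < top)"
  shows "\<exists>C>0. \<forall>f\<in>wiener_space q \<alpha>. \<forall>j.
           wiener_norm q \<gamma> (\<lambda>x. f x - quasi_interp j f (\<phi> j) (\<phi>t j) x)
             \<le> ennreal (C * 2 powr (- real j * min (\<alpha> - \<gamma>) s)) * wiener_norm q \<alpha> f"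
proof -
  have "0 < \<alpha>" using assms(3,4) by linarith
  \<comment> \<open>Either alternative yields a kernel bound uniform in \<open>j\<close> and
    \<open>k\<close>; beyond this point they are treated alike.\<close>
  obtain K where K: "0 \<le> K"
    "\<And>j k. k \<in> D_set j \<Longrightarrow> lp_norm q' (alias_kernel \<alpha> j (\<phi>t j) k) \<le> ennreal (K * (2 ^ j) powr (- \<alpha>))"
    using assms(12)
  proof
    assume i: "(q \<noteq> 1 \<longrightarrow> \<alpha> > N + enn2real (1 / q')) \<and> (q = 1 \<longrightarrow> \<alpha> \<ge> N)"
    show thesis
      using alias_kernel_bound_decay[OF assms(1,2,7) \<open>0 < \<alpha>\<close> conjunct1[OF i] conjunct2[OF i] assms(9)] that
      by blast
  next
    assume "N = 0 \<and> (SUP j. amalgam_norm q' j (\<phi>t j)) < top"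
    then show thesis
      using alias_kernel_bound_amalgam[OF assms(1,2) \<open>0 < \<alpha>\<close>, of \<phi>t] that by blast
  qed
  \<comment> \<open>The factor 4 is the constant of \<open>lp_norm_add_le\<close>; none of the other
    factors involves \<open>f\<close> or \<open>j\<close>.\<close>
  define C where "C = 4 * (2 powr (\<alpha> - \<gamma>) + \<bar>C\<^sub>s\<bar> + 2 powr \<gamma> * \<bar>C\<^sub>\<phi>\<bar> * K)"
  have "0 < 2 powr (\<alpha> - \<gamma>)" "0 \<le> 2 powr \<gamma> * \<bar>C\<^sub>\<phi>\<bar> * K" using K(1) by auto
  then have "0 < C" unfolding C_def by (simp add: add_pos_nonneg)
  moreover have "wiener_norm q \<gamma> (\<lambda>x. f x - quasi_interp j f (\<phi> j) (\<phi>t j) x)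
      \<le> ennreal (C * 2 powr (- real j * min (\<alpha> - \<gamma>) s)) * wiener_norm q \<alpha> f"
    if f: "f \<in> wiener_space q \<alpha>" for f j
  proof -
    obtain A where A: "0 \<le> A" "wiener_norm q \<alpha> f = ennreal A"
      using f by (cases "wiener_norm q \<alpha> f") (auto simp: wiener_space_def)
    have "f \<in> L1_torus" using f by (simp add: wiener_space_def)
    then have "wiener_norm q \<gamma> (\<lambda>x. f x - quasi_interp j f (\<phi> j) (\<phi>t j) x)
        \<le> ennreal (C * (2 ^ j) powr (- min (\<alpha> - \<gamma>) s) * A)"
      using quasi_interp_error_bound[OF assms(1-4,8) K(1) assms(6,10,11) K(2) _ A(1)] A(2)
      by (simp only: C_def mult.assoc order_refl)
    also have "(2 ^ j :: real) powr (- min (\<alpha> - \<gamma>) s) = 2 powr (- real j * min (\<alpha> - \<gamma>) s)"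
      by (simp add: powr_powr flip: powr_realpow)
    finally show ?thesis using A \<open>0 < C\<close> by (simp add: ennreal_mult)
  qed
  ultimately show ?thesis by blast
qed

end
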